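(* Let $k$ be a perfect field with $\mathrm{char}(k) \neq 2$ such that $-1$ is a square in $k^{\times}$, let $R$ be a smooth affine $k$-algebra and let $n \in \mathbb{N}$. Let $P_{0}$ be a finitely generated projective $R$-module of rank $2$ with a trivialization $\theta_{0}: R \xrightarrow{\cong} \det(P_{0})$ of its determinant. If $n \equiv 0$ or $1 \pmod 4$, then for every $(a_{0},a_{R}) \in Um(P_{0} \oplus R)$ one has $$V_{\theta_{0}}(a_{0},a_{R}^{n}) = n \cdot V_{\theta_{0}}(a_{0},a_{R})$$ in the group $V(R)$.
   Context: For a finitely generated projective $R$-module $P$, $Um(P)$ denotes the set of $R$-linear epimorphisms $P \to R$. An element of $Um(P_{0}\oplus R)$ is written $(a_{0},a_{R})$, where $a_{0}$ is its restriction to $P_{0}$ and $a_{R} \in R$ is its value on $(0,1)$; $(a_{0},a_{R}^{n})$ is the homomorphism with restriction $a_0$ to $P_0$ and value $a_R^n$ on $(0,1)$ (again an epimorphism). The group $V(R)$ is the quotient of the free abelian group on isometry classes of triples $(P,g,f)$, with $P$ a finitely generated projective $R$-module and $f,g$ non-degenerate alternating forms on $P$, by the relations $[P\oplus P', g\perp g', f\perp f'] = [P,g,f]+[P',g',f']$ and $[P,f_{0},f_{1}]+[P,f_{1},f_{2}] = [P,f_{0},f_{2}]$. The generalized Vaserstein symbol: let $\chi_{0}$ be the alternating form $(p,q)\mapsto \theta_{0}^{-1}(p\wedge q)$ on $P_{0}$ and $\psi_{2}$ the alternating form on $R^{2}$ with matrix $\begin{pmatrix}0&1\\-1&0\end{pmatrix}$.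 For $a \in Um(P_{0}\oplus R)$ let $P(a)=\ker(a)$, choose a section $s:R\to P_{0}\oplus R$ of $a$, let $r_{s}(p)=p-s(a(p))$ and $i_{s}:P_{0}\oplus R \to P(a)\oplus R$, $p\mapsto (r_{s}(p),a(p))$. The exact sequence $0\to P(a)\to P_{0}\oplus R\to R\to 0$ gives a canonical isomorphism $\det(P_{0})\cong\det(P(a))$, hence with $\theta_{0}$ an isomorphism $\theta:R\to\det(P(a))$, and $\chi_{a}(p,q)=\theta^{-1}(p\wedge q)$ on $P(a)$. Then $V_{\theta_{0}}(a) = [P_{0}\oplus R^{2}, \chi_{0}\perp\psi_{2}, (i_{s}\oplus 1)^{t}(\chi_{a}\perp\psi_{2})(i_{s}\oplus 1)] \in V(R)$, which is independent of the choice of $s$. *)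

theory Defs
  imports Main "HOL-Computational_Algebra.Primes"
begin

definition perfect_field :: "'k::field itself \<Rightarrow> bool" where
  "perfect_field _ \<longleftrightarrow> (\<forall>p::nat. prime p \<and> of_nat p = (0::'k) \<longrightarrow> surj (\<lambda>x::'k. x ^ p))"

definition alg_map :: "('k::field \<Rightarrow> 'r::comm_ring_1) \<Rightarrow> bool" where
  "alg_map \<phi> \<longleftrightarrow> \<phi> 1 = 1 \<and> (\<forall>x y. \<phi> (x + y) = \<phi> x + \<phi> y) \<and> (\<forall>x y. \<phi> (x * y) = \<phi> x * \<phi> y)"

inductive_set gen_alg :: "('k::field \<Rightarrow> 'r::comm_ring_1) \<Rightarrow> 'r set \<Rightarrow> 'r set"
  for \<phi> S where
  gen_const: "\<phi> c \<in> gen_alg \<phi> S"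
| gen_elem: "s \<in> S \<Longrightarrow> s \<in> gen_alg \<phi> S"
| gen_add: "x \<in> gen_alg \<phi> S \<Longrightarrow> y \<in> gen_alg \<phi> S \<Longrightarrow> x + y \<in> gen_alg \<phi> S"
| gen_mult: "x \<in> gen_alg \<phi> S \<Longrightarrow> y \<in> gen_alg \<phi> S \<Longrightarrow> x * y \<in> gen_alg \<phi> S"

definition fg_alg :: "('k::field \<Rightarrow> 'r::comm_ring_1) \<Rightarrow> bool" where
  "fg_alg \<phi> \<longleftrightarrow> (\<exists>S. finite S \<and> gen_alg \<phi> S = UNIV)"

definition r_ideal :: "'r::comm_ring_1 set \<Rightarrow> bool" where
  "r_ideal I \<longleftrightarrow> 0 \<in> I \<and> (\<forall>x\<in>I. \<forall>y\<in>I. x + y \<in> I) \<and> (\<forall>r. \<forall>x\<in>I. r * x \<in> I)"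

definition r_prime :: "'r::comm_ring_1 set \<Rightarrow> bool" where
  "r_prime I \<longleftrightarrow> r_ideal I \<and> I \<noteq> UNIV \<and> (\<forall>a b. a * b \<in> I \<longrightarrow> a \<in> I \<or> b \<in> I)"

definition r_maximal :: "'r::comm_ring_1 set \<Rightarrow> bool" where
  "r_maximal I \<longleftrightarrow> r_ideal I \<and> I \<noteq> UNIV \<and> (\<forall>J. r_ideal J \<and> I \<subseteq> J \<longrightarrow> J = I \<or> J = UNIV)"

inductive_set sq_ideal :: "'r::comm_ring_1 set \<Rightarrow> 'r set" for M where
  sq_zero: "0 \<in> sq_ideal M"
| sq_step: "z \<in> sq_ideal M \<Longrightarrow> a \<in> M \<Longrightarrow> b \<in> M \<Longrightarrow> z + a * b \<in> sq_ideal M"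

text \<open>Minimal number of elements of M generating M modulo N (for N = M^2: dim of M/M^2 over R/M).\<close>
definition mingens_mod :: "'r::comm_ring_1 set \<Rightarrow> 'r set \<Rightarrow> nat" where
  "mingens_mod M N = (LEAST r. \<exists>xs. length xs = r \<and> set xs \<subseteq> M \<and>
      (\<forall>x\<in>M. \<exists>cs. length cs = r \<and> x - (\<Sum>i<r. cs ! i * xs ! i) \<in> N))"

definition has_chain :: "'r::comm_ring_1 set \<Rightarrow> nat \<Rightarrow> bool" where
  "has_chain M l \<longleftrightarrow> (\<exists>ps. length ps = Suc l \<and> (\<forall>p\<in>set ps. r_prime p) \<and>
      (\<forall>i. Suc i < length ps \<longrightarrow> ps ! i \<subset> ps ! Suc i) \<and> last ps = M)"

text \<open>R localised at M is regular: height of M = dim_{R/M} M/M^2.\<close>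
definition regular_at :: "'r::comm_ring_1 set \<Rightarrow> bool" where
  "regular_at M \<longleftrightarrow> (\<exists>d. has_chain M d \<and> \<not> has_chain M (Suc d) \<and> mingens_mod M (sq_ideal M) = d)"

text \<open>Smooth affine k-algebra (k perfect): finitely generated and regular.\<close>
definition smooth_alg :: "('k::field \<Rightarrow> 'r::comm_ring_1) \<Rightarrow> bool" where
  "smooth_alg \<phi> \<longleftrightarrow> alg_map \<phi> \<and> fg_alg \<phi> \<and> (\<forall>M::'r set. r_maximal M \<longrightarrow> regular_at M)"

type_synonym 'r vec = "nat \<Rightarrow> 'r"
type_synonym 'r form = "'r vec \<Rightarrow> 'r vec \<Rightarrow> 'r"
type_synonym 'r triple = "nat \<times> 'r vec set \<times> 'r form \<times> 'r form"

definition vzero :: "'r::comm_ring_1 vec" where "vzero = (\<lambda>_. 0)"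
definition vadd :: "'r::comm_ring_1 vec \<Rightarrow> 'r vec \<Rightarrow> 'r vec" where "vadd x y = (\<lambda>i. x i + y i)"
definition smul :: "'r::comm_ring_1 \<Rightarrow> 'r vec \<Rightarrow> 'r vec" where "smul c x = (\<lambda>i. c * x i)"
definition vecs :: "nat \<Rightarrow> 'r::comm_ring_1 vec set" where "vecs m = {v. \<forall>i\<ge>m. v i = 0}"

definition submod :: "nat \<Rightarrow> 'r::comm_ring_1 vec set \<Rightarrow> bool" where
  "submod m P \<longleftrightarrow> P \<subseteq> vecs m \<and> vzero \<in> P \<and> (\<forall>x\<in>P. \<forall>y\<in>P. vadd x y \<in> P) \<and> (\<forall>c. \<forall>x\<in>P. smul c x \<in> P)"

definition fgproj :: "nat \<Rightarrow> 'r::comm_ring_1 vec set \<Rightarrow> bool" where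
  "fgproj m P \<longleftrightarrow> submod m P \<and> (\<exists>Q. submod m Q \<and> P \<inter> Q = {vzero} \<and>
      (\<forall>v\<in>vecs m. \<exists>p\<in>P. \<exists>q\<in>Q. v = vadd p q))"

definition lin_on :: "'r::comm_ring_1 vec set \<Rightarrow> ('r vec \<Rightarrow> 'r) \<Rightarrow> bool" where
  "lin_on P f \<longleftrightarrow> (\<forall>x\<in>P. \<forall>y\<in>P. f (vadd x y) = f x + f y) \<and> (\<forall>c. \<forall>x\<in>P. f (smul c x) = c * f x)"

definition Um :: "'r::comm_ring_1 vec set \<Rightarrow> ('r vec \<Rightarrow> 'r) \<Rightarrow> bool" where
  "Um P a \<longleftrightarrow> lin_on P a \<and> (\<forall>r. \<exists>p\<in>P. a p = r)"

definition lin_map :: "'r::comm_ring_1 vec set \<Rightarrow> ('r vec \<Rightarrow> 'r vec) \<Rightarrow> bool" where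
  "lin_map P h \<longleftrightarrow> (\<forall>x\<in>P. \<forall>y\<in>P. h (vadd x y) = vadd (h x) (h y)) \<and> (\<forall>c. \<forall>x\<in>P. h (smul c x) = smul c (h x))"

inductive_set MP :: "'r::comm_ring_1 set \<Rightarrow> 'r vec set \<Rightarrow> 'r vec set" for M P where
  MP_zero: "vzero \<in> MP M P"
| MP_step: "x \<in> MP M P \<Longrightarrow> c \<in> M \<Longrightarrow> p \<in> P \<Longrightarrow> vadd x (smul c p) \<in> MP M P"

definition gens_mod :: "'r::comm_ring_1 vec set \<Rightarrow> 'r vec set \<Rightarrow> 'r vec list \<Rightarrow> bool" where
  "gens_mod P N xs \<longleftrightarrow> set xs \<subseteq> P \<and> (\<forall>p\<in>P. \<exists>cs. length cs = length xs \<and>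
      (\<lambda>j. p j - (\<Sum>i<length xs. cs ! i * (xs ! i) j)) \<in> N)"

text \<open>dim_{R/M} (P / M P)\<close>
definition rank_at :: "'r::comm_ring_1 vec set \<Rightarrow> 'r set \<Rightarrow> nat" where
  "rank_at P M = (LEAST r. \<exists>xs. length xs = r \<and> gens_mod P (MP M P) xs)"

definition has_rank :: "'r::comm_ring_1 vec set \<Rightarrow> nat \<Rightarrow> bool" where
  "has_rank P r \<longleftrightarrow> (\<forall>M. r_maximal M \<longrightarrow> rank_at P M = r)"

definition bilin_on :: "'r::comm_ring_1 vec set \<Rightarrow> 'r form \<Rightarrow> bool" where
  "bilin_on P B \<longleftrightarrow> (\<forall>y\<in>P. lin_on P (\<lambda>x. B x y)) \<and> (\<forall>x\<in>P. lin_on P (B x))"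

definition nondeg :: "'r::comm_ring_1 vec set \<Rightarrow> 'r form \<Rightarrow> bool" where
  "nondeg P B \<longleftrightarrow> (\<forall>f. lin_on P f \<longrightarrow>
      (\<exists>x\<in>P. (\<forall>y\<in>P. B x y = f y) \<and> (\<forall>x'\<in>P. (\<forall>y\<in>P. B x' y = f y) \<longrightarrow> x' = x)))"

definition altform :: "'r::comm_ring_1 vec set \<Rightarrow> 'r form \<Rightarrow> bool" where
  "altform P B \<longleftrightarrow> bilin_on P B \<and> (\<forall>x\<in>P. B x x = 0) \<and> nondeg P B"

fun valid_triple :: "'r::comm_ring_1 triple \<Rightarrow> bool" where
  "valid_triple (m, P, g, f) \<longleftrightarrow> fgproj m P \<and> altform P g \<and> altform P f"

fun isometric :: "'r::comm_ring_1 triple \<Rightarrow> 'r triple \<Rightarrow> bool" where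
  "isometric (m, P, g, f) (m', P', g', f') \<longleftrightarrow> (\<exists>h. bij_betw h P P' \<and> lin_map P h \<and>
      (\<forall>x\<in>P. \<forall>y\<in>P. g' (h x) (h y) = g x y \<and> f' (h x) (h y) = f x y))"

definition vfst :: "nat \<Rightarrow> 'r::comm_ring_1 vec \<Rightarrow> 'r vec" where
  "vfst m u = (\<lambda>i. if i < m then u i else 0)"
definition vsnd :: "nat \<Rightarrow> 'r::comm_ring_1 vec \<Rightarrow> 'r vec" where
  "vsnd m u = (\<lambda>i. u (i + m))"
definition vsum :: "nat \<Rightarrow> 'r::comm_ring_1 vec \<Rightarrow> 'r vec \<Rightarrow> 'r vec" where
  "vsum m x y = (\<lambda>i. if i < m then x i else y (i - m))"

definition osum :: "nat \<Rightarrow> 'r::comm_ring_1 vec set \<Rightarrow> 'r vec set \<Rightarrow> 'r vec set" where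
  "osum m P P' = {vsum m x y | x y. x \<in> P \<and> y \<in> P'}"

definition oform :: "nat \<Rightarrow> 'r::comm_ring_1 form \<Rightarrow> 'r form \<Rightarrow> 'r form" where
  "oform m g g' = (\<lambda>u v. g (vfst m u) (vfst m v) + g' (vsnd m u) (vsnd m v))"

fun tsum :: "'r::comm_ring_1 triple \<Rightarrow> 'r triple \<Rightarrow> 'r triple" where
  "tsum (m, P, g, f) (m', P', g', f') = (m + m', osum m P P', oform m g g', oform m f f')"

definition delta :: "'a \<Rightarrow> 'a \<Rightarrow> int" where
  "delta T = (\<lambda>S. if S = T then 1 else 0)"

text \<open>The subgroup of the free abelian group on triples generated by the defining relations
  of V(R) (isometric triples are identified, orthogonal sum, transitivity).\<close>
inductive_set VRel :: "('r::comm_ring_1 triple \<Rightarrow> int) set" where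
  rel_iso: "valid_triple T \<Longrightarrow> valid_triple T' \<Longrightarrow> isometric T T' \<Longrightarrow>
     (\<lambda>S. delta T S - delta T' S) \<in> VRel"
| rel_sum: "valid_triple T \<Longrightarrow> valid_triple T' \<Longrightarrow>
     (\<lambda>S. delta (tsum T T') S - delta T S - delta T' S) \<in> VRel"
| rel_trans: "valid_triple (m, P, f0, f1) \<Longrightarrow> valid_triple (m, P, f1, f2) \<Longrightarrow>
     (\<lambda>S. delta (m, P, f0, f1) S + delta (m, P, f1, f2) S - delta (m, P, f0, f2) S) \<in> VRel"
| rel_zero: "(\<lambda>S. 0) \<in> VRel"
| rel_add: "x \<in> VRel \<Longrightarrow> y \<in> VRel \<Longrightarrow> (\<lambda>S. x S + y S) \<in> VRel"
| rel_neg: "x \<in> VRel \<Longrightarrow> (\<lambda>S. - x S) \<in> VRel"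

text \<open>Exterior square of R^m realised as antisymmetric matrices; p \<and> q.\<close>
definition wedge :: "'r::comm_ring_1 vec \<Rightarrow> 'r vec \<Rightarrow> (nat \<Rightarrow> nat \<Rightarrow> 'r)" where
  "wedge p q = (\<lambda>i j. p i * q j - p j * q i)"

text \<open>det(P) = \<Lambda>^2 P inside \<Lambda>^2 R^m (P a direct summand): span of the p \<and> q.\<close>
inductive_set Lam2 :: "'r::comm_ring_1 vec set \<Rightarrow> (nat \<Rightarrow> nat \<Rightarrow> 'r) set" for P where
  Lam2_zero: "(\<lambda>i j. 0) \<in> Lam2 P"
| Lam2_step: "z \<in> Lam2 P \<Longrightarrow> p \<in> P \<Longrightarrow> q \<in> P \<Longrightarrow> (\<lambda>i j. z i j + c * wedge p q i j) \<in> Lam2 P"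

text \<open>theta0 : R -> det(P), r |-> r * w, is an isomorphism.\<close>
definition det_triv :: "'r::comm_ring_1 vec set \<Rightarrow> (nat \<Rightarrow> nat \<Rightarrow> 'r) \<Rightarrow> bool" where
  "det_triv P w \<longleftrightarrow> w \<in> Lam2 P \<and> (\<forall>z\<in>Lam2 P. \<exists>!c. z = (\<lambda>i j. c * w i j))"

definition theta_form :: "(nat \<Rightarrow> nat \<Rightarrow> 'r::comm_ring_1) \<Rightarrow> 'r form" where
  "theta_form w = (\<lambda>p q. THE c. wedge p q = (\<lambda>i j. c * w i j))"

text \<open>Wedge of a 2-vector with a vector in \<Lambda>^3 R^m (trivectors as alternating 3-tensors).\<close>
definition wedge3 :: "(nat \<Rightarrow> nat \<Rightarrow> 'r::comm_ring_1) \<Rightarrow> 'r vec \<Rightarrow> (nat \<Rightarrow> nat \<Rightarrow> nat \<Rightarrow> 'r)" where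
  "wedge3 W e = (\<lambda>i j k. W i j * e k - W i k * e j + W j k * e i)"

definition unitv :: "nat \<Rightarrow> 'r::comm_ring_1 vec" where
  "unitv m = (\<lambda>i. if i = m then 1 else 0)"

text \<open>chi_a(p,q) = theta^{-1}(p \<and> q), where theta : R -> det P(a) comes from
  det P(a) (x) R = det(P0 (+) R) = det P0 (x) R, i.e. (x \<and> y) (x) 1 |-> x \<and> y \<and> s(1) and
  (p \<and> q) (x) 1 |-> (p,0) \<and> (q,0) \<and> (0,1). Here s = s(1) and m0 is the R-coordinate.\<close>
definition chi_a :: "nat \<Rightarrow> (nat \<Rightarrow> nat \<Rightarrow> 'r::comm_ring_1) \<Rightarrow> 'r vec \<Rightarrow> 'r form" where
  "chi_a m0 w s = (\<lambda>p q. THE c. wedge3 (wedge p q) s = (\<lambda>i j k. c * wedge3 w (unitv m0) i j k))"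

definition ahom :: "nat \<Rightarrow> ('r::comm_ring_1 vec \<Rightarrow> 'r) \<Rightarrow> 'r \<Rightarrow> 'r vec \<Rightarrow> 'r" where
  "ahom m0 a0 aR v = a0 (vfst m0 v) + v m0 * aR"

definition psi2 :: "'r::comm_ring_1 form" where
  "psi2 x y = x 0 * y 1 - x 1 * y 0"

definition Vsym :: "nat \<Rightarrow> 'r::comm_ring_1 vec set \<Rightarrow> (nat \<Rightarrow> nat \<Rightarrow> 'r) \<Rightarrow> ('r vec \<Rightarrow> 'r) \<Rightarrow> 'r \<Rightarrow> 'r triple" where
  "Vsym m0 P0 w a0 aR =
    (let a = ahom m0 a0 aR;
         s = (SOME s. s \<in> osum m0 P0 (vecs 1) \<and> a s = 1);
         rs = (\<lambda>x. vadd x (smul (- a x) s));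
         I = (\<lambda>x. vsum (m0 + 1) (rs (vfst (m0 + 1) x))
                (\<lambda>i. if i = 0 then a (vfst (m0 + 1) x) else if i = 1 then x (m0 + 1) else 0))
     in (m0 + 2, osum m0 P0 (vecs 2), oform m0 (theta_form w) psi2,
         (\<lambda>x y. oform (m0 + 1) (chi_a m0 w s) psi2 (I x) (I y))))"

end

theory Submission
  imports Defs "HOL-Library.Function_Algebras"
begin

text \<open>
  With \<open>\<nu> = \<chi>\<^sub>0(v, -)\<close> and a section \<open>(v, b)\<close> of \<open>a = (a\<^sub>0, e)\<close>, the second form of the symbol
  on \<open>P\<^sub>0 \<oplus> R\<^sup>2\<close> is
  \<open>F\<^sub>e = b \<chi>\<^sub>0 + e \<psi>\<^sub>2 + \<close>(cross terms built from \<open>a\<^sub>0\<close> and \<open>\<nu>\<close>). The symbol satisfies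
  \<open>V(a\<^sub>0, c\<^sup>2 d) = V(a\<^sub>0, d) + 2 V(a\<^sub>0, c)\<close>; since \<open>V(a\<^sub>0, 1) = 0\<close>, powers follow by induction in
  steps of two. For the relation, let \<open>A = R[t]/((t - c)\<^sup>2 (t - d))\<close> and push the form belonging to
  \<open>(a\<^sub>0, t)\<close> over \<open>A\<close> down to \<open>R\<close> along the coefficient of \<open>t\<^sup>2\<close>. In the basis \<open>1, t, t\<^sup>2\<close>
  the result splits as \<open>F\<close> of the norm \<open>c\<^sup>2 d\<close> of \<open>t\<close> plus a trivial form; reducing along the isotropic ideal generated by
  \<open>(t - c)(t - d)\<close> it is \<open>F\<^sub>d\<close> plus a hyperbolic plane tensored with \<open>F\<^sub>c\<close>, and over a ring
  containing \<open>1/2\<close> and \<open>\<surd>-1\<close> the hyperbolic plane is the unit form of rank two. The changes of basis are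
  unipotent, hence invisible in \<open>V(R)\<close>: scaling by 2 conjugates each of them to its square.
\<close>

section \<open>Alternating forms\<close>

lemma vadd_apply: "vadd x y i = x i + y i"
  by (simp add: vadd_def)

lemma smul_apply: "smul c x i = c * x i"
  by (simp add: smul_def)

lemma vzero_lin: "vadd x vzero = x" "vadd vzero x = x" "smul c vzero = vzero"
  "smul 0 x = vzero"
  by (auto simp: vadd_def smul_def vzero_def)

lemma submodD:
  assumes "submod m P"
  shows "x \<in> P \<Longrightarrow> y \<in> P \<Longrightarrow> vadd x y \<in> P" "x \<in> P \<Longrightarrow> smul c x \<in> P" "vzero \<in> P"
    "x \<in> P \<Longrightarrow> m \<le> i \<Longrightarrow> x i = 0"
  using assms by (auto simp: submod_def vecs_def)

lemma fgproj_submod: "fgproj m P \<Longrightarrow> submod m P"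
  by (simp add: fgproj_def)

lemma lin_onD:
  assumes "lin_on P f"
  shows "x \<in> P \<Longrightarrow> y \<in> P \<Longrightarrow> f (vadd x y) = f x + f y" "x \<in> P \<Longrightarrow> f (smul c x) = c * f x"
  using assms by (auto simp: lin_on_def)

lemma lin_mapI:
  assumes "\<And>x y. x \<in> P \<Longrightarrow> y \<in> P \<Longrightarrow> h (vadd x y) = vadd (h x) (h y)"
    "\<And>c x. x \<in> P \<Longrightarrow> h (smul c x) = smul c (h x)"
  shows "lin_map P h"
  using assms by (simp add: lin_map_def)

lemma lin_on_vzero:
  assumes "submod m P" "lin_on P f"
  shows "f vzero = 0"
proof -
  have "f (smul 0 vzero) = 0 * f vzero"
    using assms by (intro lin_onD(2)) (auto simp: submod_def)
  then show ?thesis by (simp add: smul_def vzero_def)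
qed

lemma altformD:
  assumes "altform P g"
  shows "x \<in> P \<Longrightarrow> y \<in> P \<Longrightarrow> z \<in> P \<Longrightarrow> g (vadd x y) z = g x z + g y z"
    "x \<in> P \<Longrightarrow> z \<in> P \<Longrightarrow> g (smul c x) z = c * g x z"
    "x \<in> P \<Longrightarrow> y \<in> P \<Longrightarrow> z \<in> P \<Longrightarrow> g z (vadd x y) = g z x + g z y"
    "x \<in> P \<Longrightarrow> z \<in> P \<Longrightarrow> g z (smul c x) = c * g z x"
    "x \<in> P \<Longrightarrow> g x x = 0"
  using assms by (auto simp: altform_def bilin_on_def lin_on_def)

lemma altform_skew:
  assumes "submod m P" "altform P g" "x \<in> P" "y \<in> P"
  shows "g x y = - g y x"
proof -
  have "g (vadd x y) (vadd x y) = 0"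
    using assms by (intro altformD(5)) (auto simp: submodD)
  then have "g x y + g y x = 0"
    using assms by (simp add: altformD submodD)
  then show ?thesis by (simp add: add_eq_0_iff2)
qed

text \<open>Subtracting two representing vectors reduces uniqueness to the vanishing of the left
  radical.\<close>

lemma nondegI:
  assumes "submod m P" "bilin_on P g"
    and ex: "\<And>f. lin_on P f \<Longrightarrow> \<exists>x\<in>P. \<forall>y\<in>P. g x y = f y"
    and uniq: "\<And>x. x \<in> P \<Longrightarrow> (\<And>y. y \<in> P \<Longrightarrow> g x y = 0) \<Longrightarrow> x = vzero"
  shows "nondeg P g"
  unfolding nondeg_def
proof (intro allI impI)
  fix f assume "lin_on P f"
  then obtain x where x: "x \<in> P" "\<forall>y\<in>P. g x y = f y" using ex by blast
  have "x' = x" if x': "x' \<in> P" "\<forall>y\<in>P. g x' y = f y" for x'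
  proof -
    let ?d = "vadd x' (smul (- 1) x)"
    have "?d \<in> P" using assms(1) x x' by (simp add: submodD)
    moreover have "g ?d y = 0" if "y \<in> P" for y
    proof -
      have l: "lin_on P (\<lambda>x. g x y)" using assms(2) that by (auto simp: bilin_on_def)
      show ?thesis
        using lin_onD[OF l] x x' that assms(1) by (simp add: submodD)
    qed
    ultimately have "?d = vzero" by (rule uniq)
    then show ?thesis
      by (auto simp: vadd_def smul_def vzero_def fun_eq_iff)
  qed
  then show "\<exists>x\<in>P. (\<forall>y\<in>P. g x y = f y) \<and> (\<forall>x'\<in>P. (\<forall>y\<in>P. g x' y = f y) \<longrightarrow> x' = x)"
    using x by blast
qed

lemma nondeg_ex:
  assumes "altform P B" "lin_on P f"
  shows "\<exists>x\<in>P. (\<forall>y\<in>P. B x y = f y) \<and> (\<forall>x'\<in>P. (\<forall>y\<in>P. B x' y = f y) \<longrightarrow> x' = x)"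
  using assms by (simp add: altform_def nondeg_def)

text \<open>For an alternating form, surjectivity onto the dual suffices: a vector in the radical is
  killed by all linear functionals, in particular by the coordinates.\<close>
lemma altformI:
  assumes P: "submod m P" and bil: "bilin_on P g" and diag: "\<And>x. x \<in> P \<Longrightarrow> g x x = 0"
    and ex: "\<And>f. lin_on P f \<Longrightarrow> \<exists>x\<in>P. \<forall>y\<in>P. g x y = f y"
  shows "altform P g"
proof -
  have skew: "g x y = - g y x" if "x \<in> P" "y \<in> P" for x y
  proof -
    have "g (vadd x y) (vadd x y) = g x x + g y x + (g x y + g y y)"
      using bil that submodD(1)[OF P that] by (simp add: bilin_on_def lin_on_def)
    then show ?thesis using diag that submodD(1)[OF P that] by (simp add: add_eq_0_iff2)
  qed
  have "nondeg P g"
  proof (rule nondegI[OF P bil ex])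
    fix x assume x: "x \<in> P" and 0: "\<And>y. y \<in> P \<Longrightarrow> g x y = 0"
    have "x i = 0" for i
    proof -
      have "lin_on P (\<lambda>y. y i)" by (simp add: lin_on_def vadd_def smul_def)
      from ex[OF this] obtain z where "z \<in> P" "\<forall>y\<in>P. g z y = y i" by blast
      then show ?thesis using skew[of z x] 0 x by simp
    qed
    then show "x = vzero" by (auto simp: vzero_def)
  qed
  then show ?thesis using bil diag by (simp add: altform_def)
qed

lemma altform_cong:
  assumes "submod m P" "altform P f" "\<And>x y. x \<in> P \<Longrightarrow> y \<in> P \<Longrightarrow> g x y = f x y"
  shows "altform P g"
proof -
  have "nondeg P g \<longleftrightarrow> nondeg P f"
    unfolding nondeg_def using assms(3) by (simp cong: ball_cong bex_cong)
  then show ?thesis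
    using assms unfolding altform_def bilin_on_def lin_on_def by (simp add: submodD)
qed

section \<open>Pullback of forms along isomorphisms\<close>

definition pull :: "('r::comm_ring_1 vec \<Rightarrow> 'r vec) \<Rightarrow> 'r form \<Rightarrow> 'r form" where
  "pull \<phi> f = (\<lambda>x y. f (\<phi> x) (\<phi> y))"

lemma lin_map_inv_into:
  assumes "submod m P" "bij_betw \<phi> P P'" "lin_map P \<phi>"
  shows "lin_map P' (inv_into P \<phi>)"
proof -
  let ?i = "inv_into P \<phi>"
  have inP: "?i x \<in> P" "\<phi> (?i x) = x" if "x \<in> P'" for x
    using that assms(2) by (auto simp: bij_betw_def inv_into_into f_inv_into_f)
  have inv: "?i (\<phi> x) = x" if "x \<in> P" for x
    using that assms(2) by (simp add: bij_betw_def)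
  show ?thesis unfolding lin_map_def
  proof (intro conjI ballI allI)
    fix x y assume "x \<in> P'" "y \<in> P'"
    then have "\<phi> (vadd (?i x) (?i y)) = vadd x y" "vadd (?i x) (?i y) \<in> P"
      using assms(1,3) inP by (auto simp: lin_map_def submodD)
    then show "?i (vadd x y) = vadd (?i x) (?i y)" using inv by metis
  next
    fix x c assume "x \<in> P'"
    then have "\<phi> (smul c (?i x)) = smul c x" "smul c (?i x) \<in> P"
      using assms(1,3) inP by (auto simp: lin_map_def submodD)
    then show "?i (smul c x) = smul c (?i x)" using inv by metis
  qed
qed

lemma altform_pull:
  assumes "submod m P" "bij_betw \<phi> P P'" "lin_map P \<phi>" "altform P' f"
  shows "altform P (pull \<phi> f)"
proof -
  let ?i = "inv_into P \<phi>"
  have into: "\<phi> x \<in> P'" if "x \<in> P" for x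
    using that assms(2) by (auto simp: bij_betw_def)
  have inP: "?i x \<in> P" "\<phi> (?i x) = x" if "x \<in> P'" for x
    using that assms(2) by (auto simp: bij_betw_def inv_into_into f_inv_into_f)
  have inv: "?i (\<phi> x) = x" if "x \<in> P" for x
    using that assms(2) by (simp add: bij_betw_def)
  have lin: "\<phi> (vadd x y) = vadd (\<phi> x) (\<phi> y)" if "x \<in> P" "y \<in> P" for x y
    using that assms(3) by (simp add: lin_map_def)
  have linc: "\<phi> (smul c x) = smul c (\<phi> x)" if "x \<in> P" for x c
    using that assms(3) by (simp add: lin_map_def)
  note alt = altformD[OF assms(4)]
  have bil: "bilin_on P (pull \<phi> f)"
    unfolding bilin_on_def lin_on_def pull_def by (simp add: lin linc into alt(1-4))
  moreover have "\<forall>x\<in>P. pull \<phi> f x x = 0"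
    by (simp add: pull_def into alt(5))
  moreover have "nondeg P (pull \<phi> f)"
    unfolding nondeg_def
  proof (intro allI impI)
    fix l assume l: "lin_on P l"
    have li: "?i (vadd x y) = vadd (?i x) (?i y)" "?i (smul c x) = smul c (?i x)"
      if "x \<in> P'" "y \<in> P'" for x y c
      using lin_map_inv_into[OF assms(1-3)] that by (auto simp: lin_map_def)
    \<comment> \<open>The functional is carried to \<open>P'\<close> by the inverse map and
      represented there; the representing vector is then carried back to \<open>P\<close>.\<close>
    have "lin_on P' (\<lambda>x. l (?i x))"
      unfolding lin_on_def
    proof (intro conjI ballI allI)
      show "l (?i (vadd x y)) = l (?i x) + l (?i y)" if "x \<in> P'" "y \<in> P'" for x y
        using li(1)[OF that] lin_onD(1)[OF l] inP(1) that by simp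
      show "l (?i (smul c x)) = c * l (?i x)" if "x \<in> P'" for x c
        using li(2)[OF that that] lin_onD(2)[OF l] inP(1) that by simp
    qed
    from nondeg_ex[OF assms(4) this] obtain x where x0: "x \<in> P'"
      and "(\<forall>y\<in>P'. f x y = l (?i y)) \<and> (\<forall>x'\<in>P'. (\<forall>y\<in>P'. f x' y = l (?i y)) \<longrightarrow> x' = x)"
      by (rule bexE)
    note x = x0 conjunct1[OF this(2)] conjunct2[OF this(2)]
    show "\<exists>x\<in>P. (\<forall>y\<in>P. pull \<phi> f x y = l y) \<and>
        (\<forall>x'\<in>P. (\<forall>y\<in>P. pull \<phi> f x' y = l y) \<longrightarrow> x' = x)"
    proof (intro bexI[of _ "?i x"] conjI ballI impI)
      show "?i x \<in> P" using x(1) inP by blast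
      show "pull \<phi> f (?i x) y = l y" if "y \<in> P" for y
        using x(1,2) into[OF that] inP(2)[OF x(1)] inv[OF that] by (simp add: pull_def)
      fix x' assume x': "x' \<in> P" "\<forall>y\<in>P. pull \<phi> f x' y = l y"
      have "f (\<phi> x') y = l (?i y)" if "y \<in> P'" for y
        using bspec[OF x'(2) inP(1)[OF that]] inP(2)[OF that] by (simp add: pull_def)
      then have "\<phi> x' = x" using x(3) into[OF x'(1)] by simp
      then show "x' = ?i x" using inv x' by metis
    qed
  qed
  ultimately show ?thesis by (simp add: altform_def)
qed

definition aut :: "'r::comm_ring_1 vec set \<Rightarrow> ('r vec \<Rightarrow> 'r vec) \<Rightarrow> bool" where
  "aut P \<phi> \<longleftrightarrow> lin_map P \<phi> \<and> bij_betw \<phi> P P"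

lemma autI:
  assumes "lin_map P \<phi>" "\<And>x. x \<in> P \<Longrightarrow> \<phi> x \<in> P" "\<And>x. x \<in> P \<Longrightarrow> \<psi> x \<in> P"
    "\<And>x. x \<in> P \<Longrightarrow> \<psi> (\<phi> x) = x" "\<And>x. x \<in> P \<Longrightarrow> \<phi> (\<psi> x) = x"
  shows "aut P \<phi>"
  unfolding aut_def using assms by (auto intro!: bij_betw_byWitness[where f' = \<psi>])

lemma aut_mem: "aut P \<phi> \<Longrightarrow> x \<in> P \<Longrightarrow> \<phi> x \<in> P"
  by (auto simp: aut_def bij_betw_def)

lemma aut_comp: "aut P \<phi> \<Longrightarrow> aut P \<psi> \<Longrightarrow> aut P (\<lambda>x. \<phi> (\<psi> x))"
  using bij_betw_trans[of \<psi> P P \<phi> P] aut_mem[of P \<psi>]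
  by (simp add: aut_def lin_map_def comp_def)

lemma altform_pull_aut: "submod m P \<Longrightarrow> aut P \<phi> \<Longrightarrow> altform P f \<Longrightarrow> altform P (pull \<phi> f)"
  unfolding aut_def by (blast intro: altform_pull)

section \<open>The group \<open>V(R)\<close>\<close>

text \<open>Equality of classes in \<open>V(R)\<close>: \<open>VRel\<close> is the subgroup of
  relations, and \<open>+\<close>, \<open>-\<close>, \<open>0\<close> are pointwise on
  integer-valued functions of triples.\<close>

definition veq :: "('r::comm_ring_1 triple \<Rightarrow> int) \<Rightarrow> ('r triple \<Rightarrow> int) \<Rightarrow> bool" (infix "\<approx>" 50) where
  "x \<approx> y \<longleftrightarrow> x - y \<in> VRel"

lemma VRel_0: "0 \<in> VRel"
  using rel_zero by (simp add: zero_fun_def)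
lemma VRel_add: "x \<in> VRel \<Longrightarrow> y \<in> VRel \<Longrightarrow> x + y \<in> VRel"
  using rel_add by (simp add: plus_fun_def)
lemma VRel_neg: "x \<in> VRel \<Longrightarrow> - x \<in> VRel"
  using rel_neg by (simp add: fun_Compl_def)

lemma veq_refl [simp]: "x \<approx> x"
  by (simp add: veq_def VRel_0)
lemma veq_sym: "x \<approx> y \<Longrightarrow> y \<approx> x"
  using VRel_neg[of "x - y"] by (simp add: veq_def)
lemma veq_trans [trans]: "x \<approx> y \<Longrightarrow> y \<approx> z \<Longrightarrow> x \<approx> z"
  using VRel_add[of "x - y" "y - z"] by (simp add: veq_def)
lemma veq_add: "x \<approx> y \<Longrightarrow> x' \<approx> y' \<Longrightarrow> x + x' \<approx> y + y'"
  using VRel_add[of "x - y" "x' - y'"] by (simp add: veq_def algebra_simps)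
lemma veq_add_cancel: "x + z \<approx> y + z \<longleftrightarrow> x \<approx> y" "z + x \<approx> z + y \<longleftrightarrow> x \<approx> y"
  by (simp_all add: veq_def)

lemma cl_iso:
  assumes "valid_triple (m, P, g, f)" "valid_triple (m', P', g', f')" "bij_betw h P P'" "lin_map P h"
    "\<And>x y. x \<in> P \<Longrightarrow> y \<in> P \<Longrightarrow> g' (h x) (h y) = g x y"
    "\<And>x y. x \<in> P \<Longrightarrow> y \<in> P \<Longrightarrow> f' (h x) (h y) = f x y"
  shows "delta (m, P, g, f) \<approx> delta (m', P', g', f')"
proof -
  have "isometric (m, P, g, f) (m', P', g', f')" using assms by auto
  from rel_iso[OF assms(1,2) this] show ?thesis by (simp add: veq_def fun_diff_def)
qed

text \<open>Forms are total functions, so triples whose forms differ only off \<open>P\<close> are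
  different generators. The identity of \<open>P\<close> is an isometry between them.\<close>

lemma cl_cong:
  assumes "valid_triple (m, P, g, f)"
    "\<And>x y. x \<in> P \<Longrightarrow> y \<in> P \<Longrightarrow> g' x y = g x y"
    "\<And>x y. x \<in> P \<Longrightarrow> y \<in> P \<Longrightarrow> f' x y = f x y"
  shows "delta (m, P, g, f) \<approx> delta (m, P, g', f')"
proof (rule cl_iso[where h = id])
  show "valid_triple (m, P, g', f')"
    using assms by (auto intro: altform_cong[OF fgproj_submod])
qed (use assms in \<open>auto simp: lin_map_def\<close>)

lemma cl_sum:
  assumes "valid_triple T" "valid_triple T'"
  shows "delta (tsum T T') \<approx> delta T + delta T'"
  using rel_sum[OF assms] by (simp add: veq_def fun_diff_def plus_fun_def algebra_simps)

lemma cl_trans: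
  assumes "fgproj m P" "altform P f" "altform P g" "altform P h"
  shows "delta (m, P, f, g) + delta (m, P, g, h) \<approx> delta (m, P, f, h)"
  using rel_trans[of m P f g h] assms by (simp add: veq_def fun_diff_def plus_fun_def)

text \<open>The transitivity relation for three equal forms reads \<open>x + x = x\<close>.\<close>

lemma cl_same:
  assumes "fgproj m P" "altform P f"
  shows "delta (m, P, f, f) \<approx> 0"
  using cl_trans[OF assms(1) assms(2) assms(2) assms(2)] by (simp add: veq_def)

text \<open>The class of \<open>\<phi>\<close> is its image under the hyperbolic map from \<open>K\<^sub>1\<close>, so it does not depend on the form.\<close>
lemma cl_aut_indep:
  assumes P: "fgproj m P" and "aut P \<phi>" "altform P f" "altform P g"
  shows "delta (m, P, f, pull \<phi> f) \<approx> delta (m, P, g, pull \<phi> g)"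
proof -
  note sub = fgproj_submod[OF P]
  note alt = assms(3,4) altform_pull_aut[OF sub assms(2,3)] altform_pull_aut[OF sub assms(2,4)]
  have "delta (m, P, pull \<phi> f, pull \<phi> g) \<approx> delta (m, P, f, g)"
    using alt assms by (intro cl_iso[where h = \<phi>]) (auto simp: aut_def pull_def)
  then have "delta (m, P, f, pull \<phi> f) + delta (m, P, f, g)
      \<approx> delta (m, P, f, pull \<phi> f) + delta (m, P, pull \<phi> f, pull \<phi> g)"
    by (simp add: veq_add_cancel veq_sym)
  also have "\<dots> \<approx> delta (m, P, f, pull \<phi> g)" by (intro cl_trans P alt)
  also have "\<dots> \<approx> delta (m, P, f, g) + delta (m, P, g, pull \<phi> g)"
    by (intro veq_sym[OF cl_trans] P alt)
  finally show ?thesis by (simp add: add.commute veq_add_cancel)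
qed

text \<open>Pass from \<open>f\<close> to its pullback along the composite through
  \<open>pull \<phi> f\<close>; by \<open>cl_aut_indep\<close> the second stage may be computed over
  \<open>f\<close> again. Hence the class is additive in the automorphism.\<close>

lemma cl_aut_comp:
  assumes P: "fgproj m P" and "aut P \<phi>" "aut P \<psi>" "altform P f"
  shows "delta (m, P, f, pull (\<lambda>x. \<phi> (\<psi> x)) f) \<approx> delta (m, P, f, pull \<phi> f) + delta (m, P, f, pull \<psi> f)"
proof -
  note sub = fgproj_submod[OF P]
  note alt = assms(4) altform_pull_aut[OF sub assms(2,4)] 
    altform_pull_aut[OF sub assms(3) altform_pull_aut[OF sub assms(2,4)]]
  have eq: "pull (\<lambda>x. \<phi> (\<psi> x)) f = pull \<psi> (pull \<phi> f)" by (simp add: pull_def)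
  have "delta (m, P, f, pull \<psi> (pull \<phi> f))
      \<approx> delta (m, P, f, pull \<phi> f) + delta (m, P, pull \<phi> f, pull \<psi> (pull \<phi> f))"
    by (intro veq_sym[OF cl_trans] P alt)
  also have "\<dots> \<approx> delta (m, P, f, pull \<phi> f) + delta (m, P, f, pull \<psi> f)"
    by (intro veq_add veq_refl cl_aut_indep alt P assms)
  finally show ?thesis by (simp add: eq)
qed

text \<open>If \<open>D\<close> conjugates \<open>\<phi>\<close> to its square, additivity gives
  \<open>k = k + k\<close> for the class \<open>k\<close> of \<open>\<phi>\<close>, so
  \<open>k = 0\<close>. The relation is stated without inverses, and \<open>f'\<close> by its values
  on \<open>P\<close>, so that explicit formulas can be plugged in.\<close>

lemma cl_aut_null:
  assumes P: "fgproj m P" and \<phi>: "aut P \<phi>" and D: "aut P D" and alt: "altform P g" "altform P f"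
    and comm: "\<And>x. x \<in> P \<Longrightarrow> D (\<phi> x) = \<phi> (\<phi> (D x))"
    and f': "\<And>x y. x \<in> P \<Longrightarrow> y \<in> P \<Longrightarrow> f' x y = f (\<phi> x) (\<phi> y)"
  shows "delta (m, P, g, f') \<approx> delta (m, P, g, f)"
proof -
  note sub = fgproj_submod[OF P]
  let ?k = "\<lambda>\<phi>. delta (m, P, f, pull \<phi> f)"
  note ap = altform_pull_aut[OF sub _ alt(2)]
  have "?k D + ?k \<phi> \<approx> ?k (\<lambda>x. D (\<phi> x))"
    by (rule veq_sym[OF cl_aut_comp]) (use assms in auto)
  also have "\<dots> \<approx> ?k (\<lambda>x. \<phi> (\<phi> (D x)))"
    using P alt ap[OF aut_comp[OF D \<phi>]] comm by (intro cl_cong) (auto simp: pull_def)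
  also have "\<dots> \<approx> ?k \<phi> + ?k (\<lambda>x. \<phi> (D x))"
    by (rule cl_aut_comp[OF P \<phi> aut_comp[OF \<phi> D] alt(2)])
  also have "\<dots> \<approx> ?k \<phi> + (?k \<phi> + ?k D)"
    by (intro veq_add veq_refl cl_aut_comp) (use assms in auto)
  finally have "0 + (?k \<phi> + ?k D) \<approx> ?k \<phi> + (?k \<phi> + ?k D)" by (simp add: add.commute)
  then have null: "?k \<phi> \<approx> 0" unfolding veq_add_cancel by (rule veq_sym)
  have "delta (m, P, g, f') \<approx> delta (m, P, g, pull \<phi> f)"
    using P alt ap[OF \<phi>] f' by (intro veq_sym[OF cl_cong]) (auto simp: pull_def)
  also have "\<dots> \<approx> delta (m, P, g, f) + ?k \<phi>"
    by (intro veq_sym[OF cl_trans] P alt ap \<phi>)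
  also have "\<dots> \<approx> delta (m, P, g, f) + 0" by (intro veq_add veq_refl null)
  finally show ?thesis by simp
qed

section \<open>Orthogonal sums\<close>

lemma vfst_lin: "vfst m (vadd x y) = vadd (vfst m x) (vfst m y)" "vfst m (smul c x) = smul c (vfst m x)"
  by (auto simp: vfst_def vadd_def smul_def)

lemma vsnd_lin: "vsnd m (vadd x y) = vadd (vsnd m x) (vsnd m y)" "vsnd m (smul c x) = smul c (vsnd m x)"
  by (auto simp: vsnd_def vadd_def smul_def)

lemma vsum_lin: "vadd (vsum m x y) (vsum m x' y') = vsum m (vadd x x') (vadd y y')"
  "smul c (vsum m x y) = vsum m (smul c x) (smul c y)"
  by (auto simp: vsum_def vadd_def smul_def)

lemma vsnd_vsum [simp]: "vsnd m (vsum m x y) = y"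
  by (auto simp: vsnd_def vsum_def)

lemma vfst_vsum: "submod m P \<Longrightarrow> x \<in> P \<Longrightarrow> vfst m (vsum m x y) = x"
  by (auto simp: vfst_def vsum_def submodD)

lemma vsum_split: "u = vsum m (vfst m u) (vsnd m u)"
  by (auto simp: vsum_def vfst_def vsnd_def)

lemma osum_iff:
  assumes "submod m P"
  shows "u \<in> osum m P Q \<longleftrightarrow> vfst m u \<in> P \<and> vsnd m u \<in> Q"
proof -
  have "u = vsum m (vfst m u) (vsnd m u)"
    by (auto simp: vsum_def vfst_def vsnd_def)
  then show ?thesis using assms by (auto simp: osum_def vfst_vsum)
qed

lemma osumI: "x \<in> P \<Longrightarrow> y \<in> Q \<Longrightarrow> vsum m x y \<in> osum m P Q"
  by (auto simp: osum_def)

lemma submod_osum: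
  assumes "submod m P" "submod m' P'"
  shows "submod (m + m') (osum m P P')"
  unfolding submod_def
proof (intro conjI subsetI ballI allI)
  fix u assume "u \<in> osum m P P'"
  then show "u \<in> vecs (m + m')"
    using submodD(4)[OF assms(2)] by (auto simp: osum_def vecs_def vsum_def)
next
  have "vfst m vzero = (vzero :: 'a vec)" "vsnd m vzero = (vzero :: 'a vec)"
    by (auto simp: vfst_def vsnd_def vzero_def)
  then show "vzero \<in> osum m P P'"
    using assms by (simp add: osum_iff submodD)
qed (use assms in \<open>auto simp: osum_iff vfst_lin vsnd_lin submodD\<close>)

lemma fgproj_osum:
  assumes "fgproj m P" "fgproj m' P'"
  shows "fgproj (m + m') (osum m P P')"
proof -
  obtain Q where Q: "submod m Q" "P \<inter> Q = {vzero}" "\<forall>v\<in>vecs m. \<exists>p\<in>P. \<exists>q\<in>Q. v = vadd p q"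
    using assms(1) by (auto simp: fgproj_def)
  obtain Q' where Q': "submod m' Q'" "P' \<inter> Q' = {vzero}" "\<forall>v\<in>vecs m'. \<exists>p\<in>P'. \<exists>q\<in>Q'. v = vadd p q"
    using assms(2) by (auto simp: fgproj_def)
  have sub: "submod m P" "submod m' P'" using assms by (auto simp: fgproj_def)
  have "osum m P P' \<inter> osum m Q Q' = {vzero}"
  proof
    show "osum m P P' \<inter> osum m Q Q' \<subseteq> {vzero}"
    proof
      fix u assume "u \<in> osum m P P' \<inter> osum m Q Q'"
      then have "vfst m u = vzero" "vsnd m u = vzero"
        using Q Q' sub by (auto simp: osum_iff)
      then have "vsum m (vfst m u) (vsnd m u) = vsum m vzero vzero" by simp
      then show "u \<in> {vzero}"
        by (auto simp: vsum_def vfst_def vsnd_def vzero_def fun_eq_iff split: if_splits)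
    qed
    show "{vzero} \<subseteq> osum m P P' \<inter> osum m Q Q'"
      using submodD(3)[OF submod_osum[OF sub]] submodD(3)[OF submod_osum[OF Q(1) Q'(1)]] by simp
  qed
  moreover have "\<exists>p\<in>osum m P P'. \<exists>q\<in>osum m Q Q'. v = vadd p q" if v: "v \<in> vecs (m + m')" for v
  proof -
    have "vfst m v \<in> vecs m" "vsnd m v \<in> vecs m'" using v by (auto simp: vecs_def vfst_def vsnd_def)
    then obtain p q p' q' where pq: "p \<in> P" "q \<in> Q" "vfst m v = vadd p q"
        "p' \<in> P'" "q' \<in> Q'" "vsnd m v = vadd p' q'"
      using Q(3) Q'(3) by meson
    have "v = vsum m (vfst m v) (vsnd m v)"
      by (auto simp: vsum_def vfst_def vsnd_def)
    then have "v = vadd (vsum m p p') (vsum m q q')"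
      using pq by (simp add: vsum_lin)
    then show ?thesis using pq by (blast intro: osumI)
  qed
  ultimately show ?thesis
    unfolding fgproj_def using submod_osum[OF sub] submod_osum[OF Q(1) Q'(1)] by blast
qed

lemma fgproj_vecs: "fgproj m (vecs m)"
  unfolding fgproj_def
proof (intro conjI exI[of _ "{vzero}"])
  show "\<forall>v\<in>vecs m. \<exists>p\<in>vecs m. \<exists>q\<in>{vzero}. v = vadd p q"
    by (simp add: vadd_def vzero_def)
qed (auto simp: submod_def vecs_def vadd_def smul_def vzero_def)

section \<open>Nondegeneracy of orthogonal sums and of the standard plane\<close>

lemma altform_osum:
  assumes sub: "submod m P" "submod m' P'" and alt: "altform P g" "altform P' g'"
  shows "altform (osum m P P') (oform m g g')"
proof -
  let ?O = "osum m P P'"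
  note subO = submod_osum[OF sub]
  have mem: "vfst m u \<in> P" "vsnd m u \<in> P'" if "u \<in> ?O" for u
    using that sub by (auto simp: osum_iff)
  have bil: "bilin_on ?O (oform m g g')"
    using mem unfolding bilin_on_def lin_on_def oform_def
    by (simp add: vfst_lin vsnd_lin altformD[OF alt(1)] altformD[OF alt(2)] algebra_simps)
  show ?thesis
  proof (rule altformI[OF subO bil])
    show "oform m g g' x x = 0" if "x \<in> ?O" for x
      using mem[OF that] by (simp add: oform_def altformD[OF alt(1)] altformD[OF alt(2)])
    fix f assume f: "lin_on ?O f"
    have emb: "vsum m x vzero \<in> ?O" "vsum m vzero y \<in> ?O" if "x \<in> P" "y \<in> P'" for x y
      using that sub by (auto intro!: osumI simp: submodD)
    have z: "vadd vzero vzero = (vzero::'a vec)" "smul c vzero = (vzero::'a vec)" for c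
      by (auto simp: vadd_def vzero_def smul_def)
    \<comment> \<open>The functional is restricted to both summands and represented on each of them
      separately.\<close>
    have l: "lin_on P (\<lambda>x. f (vsum m x vzero))" "lin_on P' (\<lambda>y. f (vsum m vzero y))"
      unfolding lin_on_def
    proof safe
      fix x x' c assume x: "x \<in> P" "x' \<in> P"
      show "f (vsum m (vadd x x') vzero) = f (vsum m x vzero) + f (vsum m x' vzero)"
        using lin_onD(1)[OF f] emb x submodD(3)[OF sub(2)] by (metis vsum_lin(1) z(1))
    next
      fix x c assume x: "x \<in> P"
      show "f (vsum m (smul c x) vzero) = c * f (vsum m x vzero)"
        using lin_onD(2)[OF f] emb x submodD(3)[OF sub(2)] by (metis vsum_lin(2) z(2))
    next
      fix x x' c assume x: "x \<in> P'" "x' \<in> P'"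
      show "f (vsum m vzero (vadd x x')) = f (vsum m vzero x) + f (vsum m vzero x')"
        using lin_onD(1)[OF f] emb x submodD(3)[OF sub(1)] by (metis vsum_lin(1) z(1))
    next
      fix x c assume x: "x \<in> P'"
      show "f (vsum m vzero (smul c x)) = c * f (vsum m vzero x)"
        using lin_onD(2)[OF f] emb x submodD(3)[OF sub(1)] by (metis vsum_lin(2) z(2))
    qed
    obtain x where x: "x \<in> P" "\<forall>t\<in>P. g x t = f (vsum m t vzero)"
      using nondeg_ex[OF alt(1) l(1)] by blast
    obtain y where y: "y \<in> P'" "\<forall>t\<in>P'. g' y t = f (vsum m vzero t)"
      using nondeg_ex[OF alt(2) l(2)] by blast
    show "\<exists>x\<in>?O. \<forall>y\<in>?O. oform m g g' x y = f y"
    proof (intro bexI ballI)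
      show "vsum m x y \<in> ?O" using x y by (auto intro: osumI)
      fix t assume t: "t \<in> ?O"
      have "t = vadd (vsum m (vfst m t) vzero) (vsum m vzero (vsnd m t))"
        by (auto simp: vsum_def vfst_def vsnd_def vadd_def vzero_def)
      then have "f t = f (vsum m (vfst m t) vzero) + f (vsum m vzero (vsnd m t))"
        using f emb mem[OF t] by (metis lin_on_def)
      then show "oform m g g' (vsum m x y) t = f t"
        using x y mem[OF t] sub by (simp add: oform_def vfst_vsum)
    qed
  qed
qed

lemma altform_psi2: "altform (vecs 2) (psi2 :: 'r::comm_ring_1 form)"
proof -
  have bil: "bilin_on (vecs 2) (psi2 :: 'r form)"
    by (auto simp: bilin_on_def lin_on_def psi2_def vadd_def smul_def algebra_simps)
  show ?thesis
  proof (rule altformI[OF fgproj_submod[OF fgproj_vecs] bil])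
    show "psi2 x x = 0" for x :: "'r vec" by (simp add: psi2_def)
    fix f :: "'r vec \<Rightarrow> 'r" assume f: "lin_on (vecs 2) f"
    define e where "e j = (\<lambda>i. if i = j then 1 else 0 :: 'r)" for j :: nat
    have e: "e 0 \<in> vecs 2" "e 1 \<in> vecs 2" by (auto simp: e_def vecs_def)
    \<comment> \<open>Since \<open>psi2 x y = x 0 * y 1 - x 1 * y 0\<close>, the vector
      \<open>(f (e 1), - f (e 0))\<close> represents \<open>f\<close>.\<close>
    have "psi2 (\<lambda>i. if i = 0 then f (e 1) else if i = 1 then - f (e 0) else 0) y = f y"
      if y: "y \<in> vecs 2" for y
    proof -
      have "y = vadd (smul (y 0) (e 0)) (smul (y 1) (e 1))"
        using y by (auto simp: e_def vadd_def smul_def vecs_def fun_eq_iff)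
      moreover have "smul (y 0) (e 0) \<in> vecs 2" "smul (y 1) (e 1) \<in> vecs 2"
        using submodD(2)[OF fgproj_submod[OF fgproj_vecs]] e by blast+
      ultimately have "f y = y 0 * f (e 0) + y 1 * f (e 1)"
        using f e by (metis lin_on_def)
      then show ?thesis by (simp add: psi2_def algebra_simps)
    qed
    then show "\<exists>x\<in>vecs 2. \<forall>y\<in>vecs 2. psi2 x y = f y"
      by (intro bexI[of _ "\<lambda>i. if i = 0 then f (e 1) else if i = 1 then - f (e 0) else 0"])
        (auto simp: vecs_def)
  qed
qed

section \<open>Planes with trivialised determinant\<close>

lemma Lam2_smul:
  assumes "z \<in> Lam2 P"
  shows "(\<lambda>i j. c * z i j) \<in> Lam2 P"
  using assms
proof induction
  case Lam2_zero
  then show ?case using Lam2.Lam2_zero by simp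
next
  case (Lam2_step z p q d)
  then show ?case
    using Lam2.Lam2_step[OF Lam2_step.IH Lam2_step.hyps(2,3), of "c * d"] by (simp add: algebra_simps)
qed

lemma Lam2_wedge: "p \<in> P \<Longrightarrow> q \<in> P \<Longrightarrow> wedge p q \<in> Lam2 P"
  using Lam2.Lam2_step[OF Lam2.Lam2_zero, of p P q 1] by simp

text \<open>Identities between values of \<open>theta_form\<close> are proved through this
  cancellation: multiplied by \<open>w\<close>, they become identities between explicit
  wedges.\<close>

lemma det_triv_inj:
  assumes "det_triv P w" "\<And>i j. c * w i j = c' * w i j"
  shows "c = c'"
proof -
  have "(\<lambda>i j. c * w i j) \<in> Lam2 P"
    using assms(1) by (auto simp: det_triv_def intro: Lam2_smul)
  then have "\<exists>!d. (\<lambda>i j. c * w i j) = (\<lambda>i j. d * w i j)"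
    using assms(1) by (simp add: det_triv_def)
  moreover have "(\<lambda>i j. c * w i j) = (\<lambda>i j. c' * w i j)"
    using assms(2) by presburger
  ultimately show ?thesis by blast
qed

lemma theta_form_wedge:
  assumes "det_triv P w" "p \<in> P" "q \<in> P"
  shows "wedge p q i j = theta_form w p q * w i j"
proof -
  have "\<exists>!c. wedge p q = (\<lambda>i j. c * w i j)"
    using assms Lam2_wedge unfolding det_triv_def by blast
  from theI'[OF this] have "wedge p q = (\<lambda>i j. theta_form w p q * w i j)"
    by (simp add: theta_form_def)
  then show ?thesis by (simp add: fun_eq_iff)
qed

lemma bilin_theta_form:
  assumes "submod m P" and w: "det_triv P w"
  shows "bilin_on P (theta_form w)"
proof -
  note th = theta_form_wedge[OF w, symmetric] and inj = det_triv_inj[OF w]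
  have "theta_form w (vadd x y) z = theta_form w x z + theta_form w y z"
    "theta_form w z (vadd x y) = theta_form w z x + theta_form w z y"
    if "x \<in> P" "y \<in> P" "z \<in> P" for x y z
    using that submodD(1)[OF assms(1) that(1,2)]
    by - (rule inj, simp add: th distrib_right, simp add: wedge_def vadd_def algebra_simps)+
  moreover have "theta_form w (smul c x) z = c * theta_form w x z"
    "theta_form w z (smul c x) = c * theta_form w z x"
    if "x \<in> P" "z \<in> P" for c x z
    using that submodD(2)[OF assms(1) that(1), of c]
    by - (rule inj, simp add: th mult.assoc, simp add: wedge_def smul_def algebra_simps)+
  ultimately show ?thesis by (simp add: bilin_on_def lin_on_def)
qed

lemma theta_form_diag:
  assumes "det_triv P w" "x \<in> P"
  shows "theta_form w x x = 0"
  by (rule det_triv_inj[OF assms(1)])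
    (simp add: theta_form_wedge[OF assms(1), symmetric] assms wedge_def)

section \<open>Dual bases, and nilpotence modulo an annihilator\<close>

lemma submod_sum:
  fixes k :: nat
  assumes "submod m P" "\<And>a. r a \<in> P"
  shows "(\<lambda>i. \<Sum>a<k. c a * r a i) \<in> P"
proof (induction k)
  case 0
  then show ?case using submodD(3)[OF assms(1)] by (simp add: vzero_def)
next
  case (Suc k)
  then have "vadd (\<lambda>i. \<Sum>a<k. c a * r a i) (smul (c k) (r k)) \<in> P"
    using assms by (simp add: submodD)
  then show ?case by (simp add: vadd_def smul_def)
qed

lemma lin_on_sum:
  fixes k :: nat
  assumes "submod m P" "\<And>a. r a \<in> P" "lin_on P f"
  shows "f (\<lambda>i. \<Sum>a<k. c a * r a i) = (\<Sum>a<k. c a * f (r a))"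
proof (induction k)
  case 0
  then show ?case using lin_on_vzero[OF assms(1,3)] by (simp add: vzero_def)
next
  case (Suc k)
  have "f (vadd (\<lambda>i. \<Sum>a<k. c a * r a i) (smul (c k) (r k))) = (\<Sum>a<k. c a * f (r a)) + c k * f (r k)"
    using Suc lin_onD[OF assms(3)] submod_sum[OF assms(1), of r] assms(1,2) by (simp add: submodD)
  then show ?case by (simp add: vadd_def smul_def)
qed

text \<open>\<open>r a\<close> is the projection to \<open>P\<close> of the unit vector with index
  \<open>a\<close>; the dual functionals are the coordinates.\<close>

lemma fgproj_dual_basis:
  fixes P :: "'r::comm_ring_1 vec set"
  assumes "fgproj m P"
  obtains r where "\<And>a. r a \<in> P" "\<And>p. p \<in> P \<Longrightarrow> p = (\<lambda>i. \<Sum>a<m. p a * r a i)"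
proof -
  obtain Q where Q: "submod m Q" "P \<inter> Q = {vzero}" "\<forall>v\<in>vecs m. \<exists>p\<in>P. \<exists>q\<in>Q. v = vadd p q"
    using assms by (auto simp: fgproj_def)
  have sub: "submod m P" using assms by (rule fgproj_submod)
  \<comment> \<open>Indices \<open>a \<ge> m\<close> receive the default \<open>vzero\<close>, so
    that \<open>r a\<close> lies in \<open>P\<close> for every \<open>a\<close>.\<close>
  have "\<exists>p q. p \<in> P \<and> q \<in> Q \<and> (a < m \<longrightarrow> unitv a = vadd p q)" for a :: nat
  proof (cases "a < m")
    case True
    then have "unitv a \<in> vecs m" by (auto simp: unitv_def vecs_def)
    then show ?thesis using Q(3) by blast
  next
    case False
    then show ?thesis using submodD(3)[OF sub] submodD(3)[OF Q(1)] by blast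
  qed
  then obtain r q where rq: "\<And>a. r a \<in> P" "\<And>a. q a \<in> Q" "\<And>a. a < m \<Longrightarrow> unitv a = vadd (r a) (q a)"
    by metis
  have "p = (\<lambda>i. \<Sum>a<m. p a * r a i)" if p: "p \<in> P" for p
  proof -
    define s t where st: "s = (\<lambda>i. \<Sum>a<m. p a * r a i)" "t = (\<lambda>i. \<Sum>a<m. p a * q a i)"
    have pi: "p i = s i + t i" for i
    proof -
      have "s i + t i = (\<Sum>a<m. p a * unitv a i)"
        by (simp add: st rq(3) vadd_def sum.distrib algebra_simps)
      also have "\<dots> = (\<Sum>a<m. if a = i then p a else 0)"
        by (intro sum.cong) (auto simp: unitv_def)
      also have "\<dots> = p i" using submodD(4)[OF sub p, of i] by (simp add: not_less)
      finally show ?thesis by simp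
    qed
    have "s \<in> P" "t \<in> Q" unfolding st by (intro submod_sum[OF sub rq(1)] submod_sum[OF Q(1) rq(2)])+
    moreover have "vadd p (smul (- 1) s) = t" by (simp add: vadd_def smul_def pi fun_eq_iff)
    moreover have "vadd p (smul (- 1) s) \<in> P"
      using submodD(1)[OF sub p submodD(2)[OF sub \<open>s \<in> P\<close>]] .
    ultimately have "t = vzero" using Q(2) by auto
    then have "p = s" using pi by (auto simp: vzero_def)
    then show ?thesis using st(1) by (rule trans)
  qed
  then show thesis using rq(1) that by blast
qed

text \<open>The radical of the annihilator of \<open>x\<close> is closed under addition: every
  binomial term contains \<open>s ^ k\<close> or \<open>t ^ l\<close>.\<close>

lemma annihilator_nil_add:
  fixes s t x :: "'r::comm_ring_1"
  assumes "s ^ k * x = 0" "t ^ l * x = 0"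
  shows "(s + t) ^ (k + l) * x = 0"
proof -
  have "(s + t) ^ (k + l) * x = (\<Sum>i\<le>k + l. of_nat (k + l choose i) * (s ^ i * t ^ (k + l - i) * x))"
    by (simp add: binomial_ring sum_distrib_right mult.assoc)
  also have "\<dots> = 0"
  proof (intro sum.neutral ballI)
    fix i assume "i \<in> {..k + l}"
    have "s ^ i * t ^ (k + l - i) * x = 0"
    proof (cases "k \<le> i")
      case True
      then have "s ^ i = s ^ (i - k) * s ^ k" by (simp flip: power_add)
      then have "s ^ i * t ^ (k + l - i) * x = s ^ (i - k) * t ^ (k + l - i) * (s ^ k * x)" by (simp add: mult_ac)
      then show ?thesis using assms by simp
    next
      case False
      then have "t ^ (k + l - i) = t ^ (k - i) * t ^ l" by (simp flip: power_add)
      then have "s ^ i * t ^ (k + l - i) * x = s ^ i * t ^ (k - i) * (t ^ l * x)" by (simp add: mult_ac)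
      then show ?thesis using assms by simp
    qed
    then show "of_nat (k + l choose i) * (s ^ i * t ^ (k + l - i) * x) = 0" by simp
  qed
  finally show ?thesis .
qed

lemma annihilator_nil_sum:
  fixes x :: "'r::comm_ring_1"
  assumes "finite A" "\<And>a. a \<in> A \<Longrightarrow> \<exists>k. v a ^ k * x = 0"
  shows "\<exists>k. (\<Sum>a\<in>A. v a) ^ k * x = 0"
  using assms
proof (induction A)
  case empty
  then show ?case by (intro exI[of _ 1]) simp
next
  case (insert a A)
  then obtain k l where "v a ^ k * x = 0" "(\<Sum>a\<in>A. v a) ^ l * x = 0" by blast
  from annihilator_nil_add[OF this] insert show ?case by auto
qed

locale det_plane =
  fixes m :: nat and P :: "'r::comm_ring_1 vec set" and w :: "nat \<Rightarrow> nat \<Rightarrow> 'r" and hf :: 'r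
  assumes P: "fgproj m P" and w: "det_triv P w" and hf: "2 * hf = 1"
begin

abbreviation \<chi> :: "'r form" where "\<chi> \<equiv> theta_form w"
abbreviation D :: "'r vec \<Rightarrow> 'r vec \<Rightarrow> 'r vec \<Rightarrow> nat \<Rightarrow> nat \<Rightarrow> nat \<Rightarrow> 'r" where
  "D x y \<equiv> wedge3 (wedge x y)"

lemma sub: "submod m P"
  using P by (rule fgproj_submod)

lemmas th = theta_form_wedge[OF w]

lemma chi_lin: 
  "x \<in> P \<Longrightarrow> y \<in> P \<Longrightarrow> z \<in> P \<Longrightarrow> \<chi> (vadd x y) z = \<chi> x z + \<chi> y z"
  "x \<in> P \<Longrightarrow> z \<in> P \<Longrightarrow> \<chi> (smul c x) z = c * \<chi> x z"
  "x \<in> P \<Longrightarrow> y \<in> P \<Longrightarrow> z \<in> P \<Longrightarrow> \<chi> z (vadd x y) = \<chi> z x + \<chi> z y"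
  "x \<in> P \<Longrightarrow> z \<in> P \<Longrightarrow> \<chi> z (smul c x) = c * \<chi> z x"
  using bilin_theta_form[OF sub w] by (auto simp: bilin_on_def lin_on_def)

lemma chi_skew: 
  assumes "x \<in> P" "y \<in> P"
  shows "\<chi> x y = - \<chi> y x"
  by (rule det_triv_inj[OF w]) 
    (use assms in \<open>simp add: th[symmetric], simp add: wedge_def algebra_simps\<close>)

section \<open>Vanishing of the third exterior power\<close>

lemma times_2_cancel:
  fixes r :: 'r
  assumes "2 * r = 0" shows "r = 0"
proof -
  have "hf * (2 * r) = r" using hf by (metis mult.assoc mult.commute mult_1)
  then show ?thesis using assms by simp
qed

text \<open>The product is a 2x2 minor in entries of \<open>wedge x y\<close> and
  \<open>wedge x z\<close>. Both wedges are multiples of the same \<open>w\<close>, so the minor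
  vanishes.\<close>

lemma D_diag:
  assumes "x \<in> P" "y \<in> P" "z \<in> P"
  shows "x i * D x y z i j l = 0"
proof -
  have "x i * D x y z i j l = wedge x y i j * wedge x z i l - wedge x y i l * wedge x z i j"
    by (simp add: wedge3_def wedge_def algebra_simps)
  also have "\<dots> = 0" using assms by (simp add: th algebra_simps)
  finally show ?thesis .
qed

text \<open>Polarising \<open>D_diag\<close> shows that \<open>t i * D x y z i j l\<close> is alternating in \<open>t, x, y, z\<close>; its
  alternating sum is a determinant with two equal rows.\<close>
lemma D_kill:
  assumes "x \<in> P" "y \<in> P" "z \<in> P" "t \<in> P"
  shows "t i * D x y z i j l = 0"
proof -
  let ?d = "\<lambda>x y z. D x y z i j l"
  have 1: "t i * ?d x y z + x i * ?d t y z = 0"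
  proof -
    have "vadd x t i * ?d (vadd x t) y z = 0" using assms sub by (intro D_diag) (auto simp: submodD)
    moreover have "vadd x t i * ?d (vadd x t) y z
      = x i * ?d x y z + t i * ?d t y z + (t i * ?d x y z + x i * ?d t y z)"
      by (simp add: wedge3_def wedge_def vadd_def algebra_simps)
    ultimately show ?thesis using assms by (simp add: D_diag add_eq_0_iff)
  qed
  have 2: "t i * ?d x y z + y i * ?d x t z = 0"
  proof -
    have "vadd y t i * ?d (vadd y t) x z = 0" using assms sub by (intro D_diag) (auto simp: submodD)
    moreover have "vadd y t i * ?d (vadd y t) x z
      = y i * ?d y x z + t i * ?d t x z - (t i * ?d x y z + y i * ?d x t z)"
      by (simp add: wedge3_def wedge_def vadd_def algebra_simps)
    ultimately show ?thesis using assms by (simp add: D_diag add_eq_0_iff)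
  qed
  have 3: "t i * ?d x y z + z i * ?d x y t = 0"
  proof -
    have "vadd z t i * ?d (vadd z t) x y = 0" using assms sub by (intro D_diag) (auto simp: submodD)
    moreover have "vadd z t i * ?d (vadd z t) x y
      = z i * ?d z x y + t i * ?d t x y + (t i * ?d x y z + z i * ?d x y t)"
      by (simp add: wedge3_def wedge_def vadd_def algebra_simps)
    ultimately show ?thesis using assms by (simp add: D_diag add_eq_0_iff)
  qed
  have 4: "t i * ?d x y z - x i * ?d t y z - y i * ?d x t z - z i * ?d x y t = 0"
    by (simp add: wedge3_def wedge_def algebra_simps)
  have "2 * (2 * (t i * ?d x y z)) = (t i * ?d x y z - x i * ?d t y z - y i * ?d x t z - z i * ?d x y t)
    + (t i * ?d x y z + x i * ?d t y z) + (t i * ?d x y z + y i * ?d x t z)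
    + (t i * ?d x y z + z i * ?d x y t)"
    by (simp add: algebra_simps)
  then have "2 * (2 * (t i * ?d x y z)) = 0" using 1 2 3 4 by simp
  then show ?thesis using times_2_cancel by blast
qed

text \<open>Each summand \<open>wedge p q i j\<close> has a factor \<open>p i\<close> or
  \<open>q i\<close> in every term, and \<open>D_kill\<close> applies to these.\<close>

lemma Lam2_kill:
  assumes "W \<in> Lam2 P" "x \<in> P" "y \<in> P" "z \<in> P"
  shows "W i j * D x y z i j l = 0"
  using assms(1)
proof induction
  case (Lam2_step W p q c)
  have "(W i j + c * wedge p q i j) * D x y z i j l
    = W i j * D x y z i j l + c * (q j * (p i * D x y z i j l) - p j * (q i * D x y z i j l))"
    by (simp add: wedge_def algebra_simps)
  then show ?case using Lam2_step assms(2-4) by (simp add: D_kill)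
qed simp

text \<open>The trivector \<open>x \<and> y \<and> z\<close> is \<open>w\<close> times this vector,
  entry by entry (\<open>D_cyc\<close>). Its vanishing is Cramer's rule in rank two.\<close>

definition cyc :: "'r vec \<Rightarrow> 'r vec \<Rightarrow> 'r vec \<Rightarrow> 'r vec" where
  "cyc x y z = (\<lambda>l. \<chi> x y * z l + \<chi> y z * x l + \<chi> z x * y l)"

lemma D_cyc:
  assumes "x \<in> P" "y \<in> P" "z \<in> P"
  shows "D x y z i j l = w i j * cyc x y z l"
proof -
  have "D x y z i j l = wedge x y i j * z l + wedge y z i j * x l + wedge z x i j * y l"
    by (simp add: wedge3_def wedge_def algebra_simps)
  then show ?thesis using assms by (simp add: th cyc_def algebra_simps)
qed

lemma w_in: "w \<in> Lam2 P"
  using w by (simp add: det_triv_def)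

text \<open>Let \<open>h\<close> be the matrix of \<open>\<chi>\<close> in a dual basis. Pairing
  with \<open>h\<close> sends \<open>wedge p q\<close> to \<open>2 * \<chi> p q\<close>, hence
  \<open>w\<close> to 2, which is a unit.\<close>

lemma w_unimodular:
  obtains h where "(\<Sum>i<m. \<Sum>j<m. w i j * h i j) = 2"
proof -
  obtain r where r: "\<And>a. r a \<in> P" "\<And>p. p \<in> P \<Longrightarrow> p = (\<lambda>i. \<Sum>a<m. p a * r a i)"
    using fgproj_dual_basis[OF P] by blast
  define h where "h = (\<lambda>i j. \<chi> (r i) (r j))"
  have h: "\<chi> p q = (\<Sum>i<m. \<Sum>j<m. p i * q j * h i j)" if "p \<in> P" "q \<in> P" for p q
  proof -
    have l: "lin_on P (\<lambda>p. \<chi> p q)" "lin_on P (\<chi> (r i))" for i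
      using bilin_theta_form[OF sub w] that r by (auto simp: bilin_on_def)
    have "\<chi> p q = \<chi> (\<lambda>i. \<Sum>a<m. p a * r a i) q" using r(2)[OF that(1)] by simp
    also have "\<dots> = (\<Sum>i<m. p i * \<chi> (r i) q)" by (rule lin_on_sum[OF sub r(1) l(1)])
    also have "\<dots> = (\<Sum>i<m. p i * \<chi> (r i) (\<lambda>i. \<Sum>a<m. q a * r a i))" using r(2)[OF that(2)] by simp
    also have "\<dots> = (\<Sum>i<m. p i * (\<Sum>j<m. q j * \<chi> (r i) (r j)))"
      by (simp add: lin_on_sum[OF sub r(1) l(2)])
    finally show ?thesis by (simp add: h_def sum_distrib_left mult.assoc)
  qed
  have wedge: "(\<Sum>i<m. \<Sum>j<m. wedge p q i j * h i j) = 2 * \<chi> p q" if "p \<in> P" "q \<in> P" for p q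
  proof -
    have "(\<Sum>i<m. \<Sum>j<m. wedge p q i j * h i j)
       = (\<Sum>i<m. \<Sum>j<m. p i * q j * h i j) - (\<Sum>i<m. \<Sum>j<m. q i * p j * h i j)"
      by (simp add: wedge_def algebra_simps sum_subtractf)
    also have "\<dots> = \<chi> p q - \<chi> q p" using that by (simp add: h)
    finally show ?thesis using chi_skew[OF that] by simp
  qed
  \<comment> \<open>The induction carries the coordinate \<open>c\<close> of \<open>W\<close> along
    with the value of the pairing; for \<open>W = w\<close> injectivity forces
    \<open>c = 1\<close>.\<close>
  have "\<exists>c. W = (\<lambda>i j. c * w i j) \<and> (\<Sum>i<m. \<Sum>j<m. W i j * h i j) = 2 * c" if "W \<in> Lam2 P" for W
    using that
  proof induction
    case Lam2_zero
    then show ?case by (intro exI[of _ 0]) simp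
  next
    case (Lam2_step W p q c)
    then obtain d where d: "W = (\<lambda>i j. d * w i j)" "(\<Sum>i<m. \<Sum>j<m. W i j * h i j) = 2 * d" by blast
    have "(\<Sum>i<m. \<Sum>j<m. (W i j + c * wedge p q i j) * h i j)
      = 2 * d + c * (\<Sum>i<m. \<Sum>j<m. wedge p q i j * h i j)"
      by (simp add: d(2)[symmetric] distrib_right sum.distrib sum_distrib_left mult.assoc)
    then show ?case using Lam2_step.hyps
      by (intro exI[of _ "d + c * \<chi> p q"]) (simp add: wedge d(1), simp add: th algebra_simps)
  qed
  from this[OF w_in] obtain c where c: "w = (\<lambda>i j. c * w i j)" "(\<Sum>i<m. \<Sum>j<m. w i j * h i j) = 2 * c"
    by blast
  have "1 = c"
    by (rule det_triv_inj[OF w]) (use c(1) in \<open>metis mult_1\<close>)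
  then show thesis using that c(2) by simp
qed

text \<open>This is \<open>\<Lambda>\<^sup>3 P = 0\<close>. Each entry of \<open>w\<close> is nilpotent modulo the annihilator of
  \<open>cyc x y z l\<close>, while these entries generate the unit ideal.\<close>
lemma cyc_zero:
  assumes "x \<in> P" "y \<in> P" "z \<in> P"
  shows "cyc x y z l = 0"
proof -
  obtain h where h: "(\<Sum>i<m. \<Sum>j<m. w i j * h i j) = 2" using w_unimodular by blast
  let ?N = "cyc x y z l"
  have "(w i j * h i j) ^ 2 * ?N = 0" for i j
  proof -
    have "w i j * (w i j * ?N) = 0"
      using Lam2_kill[OF w_in assms] D_cyc[OF assms] by simp
    moreover have "(w i j * h i j) ^ 2 * ?N = h i j ^ 2 * (w i j * (w i j * ?N))"
      by (simp add: power2_eq_square mult_ac)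
    ultimately show ?thesis by simp
  qed
  then have "\<exists>k. (\<Sum>i<m. \<Sum>j<m. w i j * h i j) ^ k * ?N = 0"
    by (intro annihilator_nil_sum) auto
  then obtain k where "2 ^ k * ?N = 0" using h by auto
  moreover have "?N = hf ^ k * (2 ^ k * ?N)"
    by (simp add: mult.assoc[symmetric] power_mult_distrib[symmetric] mult.commute[of hf] hf)
  ultimately show ?thesis by simp
qed

lemma D_zero: "x \<in> P \<Longrightarrow> y \<in> P \<Longrightarrow> z \<in> P \<Longrightarrow> D x y z i j l = 0"
  by (simp add: D_cyc cyc_zero)

text \<open>This is \<open>f\<close> applied to the zero vector \<open>cyc x y z\<close>.\<close>

lemma lin_on_cyc:
  assumes f: "lin_on P f" and xyz: "x \<in> P" "y \<in> P" "z \<in> P"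
  shows "\<chi> x y * f z + \<chi> y z * f x + \<chi> z x * f y = 0"
proof -
  have "f (vadd (vadd (smul (\<chi> x y) z) (smul (\<chi> y z) x)) (smul (\<chi> z x) y))
    = \<chi> x y * f z + \<chi> y z * f x + \<chi> z x * f y"
    using xyz sub by (simp add: lin_onD[OF f] submodD)
  moreover have "vadd (vadd (smul (\<chi> x y) z) (smul (\<chi> y z) x)) (smul (\<chi> z x) y) = vzero"
    using cyc_zero[OF xyz] by (auto simp: cyc_def vadd_def smul_def vzero_def)
  ultimately show ?thesis using lin_on_vzero[OF sub f] by simp
qed

lemma altform_chi: "altform P \<chi>"
proof -
  show ?thesis
  proof (rule altformI[OF sub bilin_theta_form[OF sub w]])
    show "\<chi> x x = 0" if "x \<in> P" for x by (rule theta_form_diag[OF w that])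
    fix f assume f: "lin_on P f"
    \<comment> \<open>By \<open>lin_on_cyc\<close>, \<open>f q * p - f p * q\<close> represents
      \<open>\<chi> p q * f\<close>. Summing over an expression of \<open>w\<close> by wedges gives
      a vector that represents \<open>f\<close> itself.\<close>
    have "\<exists>x\<in>P. \<exists>c. W = (\<lambda>i j. c * w i j) \<and> (\<forall>t\<in>P. \<chi> x t = c * f t)" if "W \<in> Lam2 P" for W
      using that
    proof induction
      case Lam2_zero
      have "\<chi> vzero t = 0" if "t \<in> P" for t
        using lin_on_vzero[OF sub, of "\<lambda>x. \<chi> x t"] bilin_theta_form[OF sub w] that
        by (simp add: bilin_on_def)
      then show ?case using submodD(3)[OF sub] 
        by (intro bexI[of _ vzero] exI[of _ 0]) auto
    next
      case (Lam2_step W p q c)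
      then obtain x d where x: "x \<in> P" "W = (\<lambda>i j. d * w i j)" "\<forall>t\<in>P. \<chi> x t = d * f t" by blast
      let ?x = "vadd x (smul c (vadd (smul (f q) p) (smul (- f p) q)))"
      have pq: "p \<in> P" "q \<in> P" using Lam2_step by auto
      have "\<chi> ?x t = (d + c * \<chi> p q) * f t" if t: "t \<in> P" for t
      proof -
        have "\<chi> ?x t = d * f t + c * (f q * \<chi> p t - f p * \<chi> q t)"
          using x pq t sub by (simp add: chi_lin submodD algebra_simps)
        moreover have "f q * \<chi> p t - f p * \<chi> q t = \<chi> p q * f t"
          using lin_on_cyc[OF f pq t] chi_skew[OF t pq(1)] 
          by (simp add: add_eq_0_iff algebra_simps)
        ultimately show ?thesis by (simp add: algebra_simps)
      qed
      moreover have "?x \<in> P" using x pq sub by (simp add: submodD)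
      ultimately show ?case using x pq
        by (intro bexI[of _ ?x] exI[of _ "d + c * \<chi> p q"]) (auto simp: th algebra_simps)
    qed
    from this[OF w_in] obtain x c where x: "x \<in> P" "w = (\<lambda>i j. c * w i j)" "\<forall>t\<in>P. \<chi> x t = c * f t"
      by blast
    have "1 = c"
      by (rule det_triv_inj[OF w]) (use x(2) in \<open>metis mult_1\<close>)
    then show "\<exists>x\<in>P. \<forall>y\<in>P. \<chi> x y = f y" using x by auto
  qed
qed

section \<open>The form on the kernel of a unimodular element\<close>

lemma w_support:
  assumes "m \<le> i \<or> m \<le> j"
  shows "w i j = 0"
proof -
  have "W i j = 0" if "W \<in> Lam2 P" for W
    using that assms
  proof induction
    case (Lam2_step W p q c)
    then show ?case
      using submodD(4)[OF sub Lam2_step.hyps(2)] submodD(4)[OF sub Lam2_step.hyps(3)]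
      by (elim disjE) (simp_all add: wedge_def)
  qed simp
  then show ?thesis using w_in by blast
qed

text \<open>Expand \<open>p \<and> q \<and> s\<close> along \<open>P \<oplus> R\<close>. The part
  inside \<open>P\<close> vanishes by \<open>D_zero\<close>, and each remaining term is a wedge of
  two vectors of \<open>P\<close> with the last unit vector, hence a multiple of \<open>w\<close>
  wedged with it.\<close>

lemma chi_a_eq:
  assumes p: "p \<in> osum m P (vecs 1)" and q: "q \<in> osum m P (vecs 1)" and s: "s \<in> osum m P (vecs 1)"
  shows "chi_a m w s p q = s m * \<chi> (vfst m p) (vfst m q) + q m * \<chi> (vfst m s) (vfst m p)
    + p m * \<chi> (vfst m q) (vfst m s)"
proof -
  let ?c = "s m * \<chi> (vfst m p) (vfst m q) + q m * \<chi> (vfst m s) (vfst m p)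
    + p m * \<chi> (vfst m q) (vfst m s)"
  let ?e = "unitv m :: 'r vec"
  have split: "u i = vfst m u i + u m * ?e i" if "u \<in> osum m P (vecs 1)" for u i
  proof -
    have "u (i - m + m) = 0" if "m < i"
    proof -
      have "vsnd m u \<in> vecs 1" using \<open>u \<in> _\<close> by (simp add: osum_iff[OF sub])
      moreover have "1 \<le> i - m" using that by simp
      ultimately have "vsnd m u (i - m) = 0" unfolding vecs_def by blast
      then show ?thesis by (simp add: vsnd_def)
    qed
    then show ?thesis by (cases i m rule: linorder_cases) (simp_all add: vfst_def unitv_def)
  qed
  have mem: "vfst m u \<in> P" if "u \<in> osum m P (vecs 1)" for u
    using that by (simp add: osum_iff[OF sub])
  have tri: "wedge3 (wedge p q) s i j k = ?c * wedge3 w ?e i j k" for i j k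
  proof -
    let ?p = "vfst m p" and ?q = "vfst m q" and ?s = "vfst m s"
    have "wedge3 (wedge p q) s i j k = D ?p ?q ?s i j k + s m * wedge3 (wedge ?p ?q) ?e i j k
      + q m * wedge3 (wedge ?s ?p) ?e i j k + p m * wedge3 (wedge ?q ?s) ?e i j k"
      unfolding wedge3_def wedge_def 
        split[OF p, of i] split[OF p, of j] split[OF p, of k]
        split[OF q, of i] split[OF q, of j] split[OF q, of k]
        split[OF s, of i] split[OF s, of j] split[OF s, of k]
      by (simp add: algebra_simps)
    moreover have "D ?p ?q ?s i j k = 0" using mem p q s by (intro D_zero) auto
    moreover have "wedge3 (wedge x y) ?e i j k = \<chi> x y * wedge3 w ?e i j k" if "x \<in> P" "y \<in> P" for x y
      using that by (simp add: wedge3_def th algebra_simps)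
    ultimately show ?thesis using mem p q s by (simp add: algebra_simps)
  qed
  show ?thesis unfolding chi_a_def
  proof (rule the_equality)
    show "wedge3 (wedge p q) s = (\<lambda>i j k. ?c * wedge3 w ?e i j k)"
      using tri by (simp add: fun_eq_iff)
    fix c assume "wedge3 (wedge p q) s = (\<lambda>i j k. c * wedge3 w ?e i j k)"
    then have eq: "c * wedge3 w ?e i j k = ?c * wedge3 w ?e i j k" for i j k
      using tri by (metis (no_types, lifting))
    show "c = ?c"
    proof (rule det_triv_inj[OF w])
      fix i j
      show "c * w i j = ?c * w i j"
      proof (cases "i < m \<and> j < m")
        case True
        \<comment> \<open>Setting the third index to \<open>m\<close> recovers \<open>w\<close>, so
          the coefficient is unique.\<close>
        then have "wedge3 w ?e i j m = w i j" by (simp add: wedge3_def unitv_def)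
        then show ?thesis using eq[of i j m] by simp
      next
        case False
        then show ?thesis using w_support by (simp add: not_less)
      qed
    qed
  qed
qed

end

section \<open>Unipotent automorphisms and hyperbolic planes\<close>

text \<open>Here \<open>\<pi>\<close> is a projection that fixes the values of \<open>N\<close>, and
  \<open>N\<close> vanishes on its image. Hence \<open>1 + \<pi>\<close> conjugates
  \<open>1 + N\<close> to \<open>1 + 2 N\<close>, which is the square of
  \<open>1 + N\<close>.\<close>

locale unipotent =
  fixes m :: nat and P :: "'r::comm_ring_1 vec set" and hf :: 'r and N \<pi> :: "'r vec \<Rightarrow> 'r vec"
  assumes P: "fgproj m P" and hf: "2 * hf = 1"
    and linN: "lin_map P N" and linp: "lin_map P \<pi>"
    and N: "\<And>x. x \<in> P \<Longrightarrow> N x \<in> P" and p: "\<And>x. x \<in> P \<Longrightarrow> \<pi> x \<in> P"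
    and pp: "\<And>x. x \<in> P \<Longrightarrow> \<pi> (\<pi> x) = \<pi> x" and pN: "\<And>x. x \<in> P \<Longrightarrow> \<pi> (N x) = N x"
    and Np: "\<And>x. x \<in> P \<Longrightarrow> N (\<pi> x) = vzero"
begin

lemma sub: "submod m P" using P by (rule fgproj_submod)

lemma lin:
  "x \<in> P \<Longrightarrow> y \<in> P \<Longrightarrow> N (vadd x y) = vadd (N x) (N y)" "x \<in> P \<Longrightarrow> N (smul c x) = smul c (N x)"
  "x \<in> P \<Longrightarrow> y \<in> P \<Longrightarrow> \<pi> (vadd x y) = vadd (\<pi> x) (\<pi> y)" "x \<in> P \<Longrightarrow> \<pi> (smul c x) = smul c (\<pi> x)"
  using linN linp by (auto simp: lin_map_def)

lemma NN: "x \<in> P \<Longrightarrow> N (N x) = vzero"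
  using Np[OF N] pN by simp

lemma aut: "aut P (\<lambda>x. vadd x (N x))"
proof (rule autI[where \<psi> = "\<lambda>x. vadd x (smul (- 1) (N x))"])
  show "lin_map P (\<lambda>x. vadd x (N x))"
    using N sub unfolding lin_map_def
    by (simp add: lin) (simp add: vadd_def smul_def algebra_simps)
  fix x assume x: "x \<in> P"
  show "vadd x (N x) \<in> P" "vadd x (smul (- 1) (N x)) \<in> P"
    using x N sub by (simp_all add: submodD)
  have "N (vadd x (N x)) = N x" "N (vadd x (smul (- 1) (N x))) = N x"
    using x N sub by (simp_all add: lin submodD NN vzero_lin)
  then show "vadd (vadd x (N x)) (smul (- 1) (N (vadd x (N x)))) = x"
    "vadd (vadd x (smul (- 1) (N x))) (N (vadd x (smul (- 1) (N x)))) = x"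
    by (auto simp: vadd_def smul_def)
qed

text \<open>\<open>1 + \<pi>\<close> doubles the image of \<open>\<pi>\<close> and fixes its kernel,
  so its inverse is \<open>1 - hf * \<pi>\<close>.\<close>

lemma aut_scale: "aut P (\<lambda>x. vadd x (\<pi> x))"
proof (rule autI[where \<psi> = "\<lambda>x. vadd x (smul (- hf) (\<pi> x))"])
  show "lin_map P (\<lambda>x. vadd x (\<pi> x))"
    using p sub unfolding lin_map_def
    by (simp add: lin) (simp add: vadd_def smul_def algebra_simps)
  fix x assume x: "x \<in> P"
  show "vadd x (\<pi> x) \<in> P" "vadd x (smul (- hf) (\<pi> x)) \<in> P"
    using x p sub by (simp_all add: submodD)
  have h: "hf + hf = 1" using hf by (simp only: mult_2)
  have h': "hf * r + hf * r = r" for r using h by (metis distrib_right mult_1)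
  have e: "\<pi> (vadd x (\<pi> x)) = vadd (\<pi> x) (\<pi> x)"
    "\<pi> (vadd x (smul (- hf) (\<pi> x))) = vadd (\<pi> x) (smul (- hf) (\<pi> x))"
    using x p sub by (simp_all add: lin submodD pp)
  have 1: "x i + \<pi> x i + - hf * (\<pi> x i + \<pi> x i) = x i + \<pi> x i - (hf * \<pi> x i + hf * \<pi> x i)" for i
    by (simp add: algebra_simps)
  show "vadd (vadd x (\<pi> x)) (smul (- hf) (\<pi> (vadd x (\<pi> x)))) = x"
    unfolding e unfolding vadd_def smul_def by (simp only: 1 h' add_diff_cancel_right')
  have 2: "x i + - hf * \<pi> x i + (\<pi> x i + - hf * \<pi> x i) = x i + \<pi> x i - (hf * \<pi> x i + hf * \<pi> x i)" for i
    by (simp add: algebra_simps)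
  show "vadd (vadd x (smul (- hf) (\<pi> x))) (\<pi> (vadd x (smul (- hf) (\<pi> x)))) = x"
    unfolding e unfolding vadd_def smul_def by (simp only: 2 h' add_diff_cancel_right')
qed

text \<open>Both directions serve later: nondegeneracy is carried back from an orthogonal sum to
  \<open>\<Phi>\<close>, and forward from \<open>\<Phi>\<close> to \<open>\<Psi>\<close>.\<close>

lemma altform_iff:
  assumes f': "\<And>x y. x \<in> P \<Longrightarrow> y \<in> P \<Longrightarrow> f' x y = f (vadd x (N x)) (vadd y (N y))"
  shows "altform P f' \<longleftrightarrow> altform P f"
proof
  assume "altform P f"
  from altform_pull_aut[OF sub aut this] show "altform P f'"
    by (rule altform_cong[OF sub]) (simp add: f' pull_def)
next
  assume a: "altform P f'"
  let ?\<phi> = "\<lambda>x. vadd x (N x)"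
  have b: "bij_betw ?\<phi> P P" and l: "lin_map P ?\<phi>" using aut by (simp_all add: aut_def)
  have b': "bij_betw (inv_into P ?\<phi>) P P" using b by (rule bij_betw_inv_into)
  have "altform P (pull (inv_into P ?\<phi>) f')"
    by (rule altform_pull[OF sub b' lin_map_inv_into[OF sub b l] a])
  then show "altform P f"
  proof (rule altform_cong[OF sub])
    fix x y assume "x \<in> P" "y \<in> P"
    then show "f x y = pull (inv_into P ?\<phi>) f' x y"
      using b bij_betw_apply[OF b'] bij_betw_inv_into_right[OF b] by (simp add: pull_def f')
  qed
qed

lemma cl_eq:
  assumes "altform P g" "altform P f"
    and "\<And>x y. x \<in> P \<Longrightarrow> y \<in> P \<Longrightarrow> f' x y = f (vadd x (N x)) (vadd y (N y))"
  shows "delta (m, P, g, f') \<approx> delta (m, P, g, f)"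
proof (rule cl_aut_null[OF P aut aut_scale assms(1,2) _ assms(3)])
  fix x assume x: "x \<in> P"
  have 1: "N (vadd x (\<pi> x)) = N x" using x p by (simp add: lin Np vzero_lin)
  have 2: "\<pi> (vadd x (N x)) = vadd (\<pi> x) (N x)" using x N by (simp add: lin pN)
  have 3: "N (vadd (vadd x (\<pi> x)) (N x)) = N x" 
    using x p N sub 1 by (simp add: lin(1) NN vzero_lin submodD)
  show "vadd (vadd x (N x)) (\<pi> (vadd x (N x)))
    = vadd (vadd (vadd x (\<pi> x)) (N (vadd x (\<pi> x)))) (N (vadd (vadd x (\<pi> x)) (N (vadd x (\<pi> x)))))"
    unfolding 1 2 3 by (simp add: vadd_def algebra_simps)
qed

end

text \<open>The tensor product of \<open>g\<close> with the symmetric hyperbolic plane, whose matrix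
  has rows \<open>(0, 1)\<close> and \<open>(1, 0)\<close>.\<close>

definition hform :: "nat \<Rightarrow> 'r::comm_ring_1 form \<Rightarrow> 'r form" where
  "hform m g = (\<lambda>u v. g (vfst m u) (vsnd m v) + g (vsnd m u) (vfst m v))"

text \<open>With \<open>1/2\<close> and \<open>i = \<surd>-1\<close> in the ring, \<open>s, r \<mapsto> (s + i r, (s - i r) / 2)\<close> turns the
  hyperbolic plane into the unit form of rank 2.\<close>
lemma hform_isometry:
  fixes hf im :: "'r::comm_ring_1" and P :: "'r vec set"
  assumes P: "fgproj m P" and hf: "2 * hf = 1" and im: "im * im = - 1"
  obtains E where "bij_betw E (osum m P P) (osum m P P)" "lin_map (osum m P P) E"
    "\<And>g u v. altform P g \<Longrightarrow> u \<in> osum m P P \<Longrightarrow> v \<in> osum m P P \<Longrightarrow>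
      hform m g (E u) (E v) = oform m g g u v"
proof -
  note sub = fgproj_submod[OF P]
  let ?O = "osum m P P"
  define E where "E = (\<lambda>u. vsum m (vadd (vfst m u) (smul im (vsnd m u)))
    (smul hf (vadd (vfst m u) (smul (- im) (vsnd m u)))))"
  define E' where "E' = (\<lambda>u. vsum m (vadd (smul hf (vfst m u)) (vsnd m u))
    (smul im (vadd (vsnd m u) (smul (- hf) (vfst m u)))))"
  have "hf + hf = 1" using hf by (simp only: mult_2)
  then have h: "hf * r + hf * r = r" for r by (metis distrib_right mult_1)
  have i: "im * (im * r) = - r" for r using im by (simp flip: mult.assoc)
  have mem: "vfst m u \<in> P" "vsnd m u \<in> P" if "u \<in> ?O" for u
    using that by (auto simp: osum_iff[OF sub])
  have EO: "E u \<in> ?O" "E' u \<in> ?O" if "u \<in> ?O" for u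
    using mem[OF that] sub by (auto simp: E_def E'_def intro!: osumI simp: submodD)
  have fE: "vfst m (E u) = vadd (vfst m u) (smul im (vsnd m u))"
    "vfst m (E' u) = vadd (smul hf (vfst m u)) (vsnd m u)" if "u \<in> ?O" for u
    using mem[OF that] sub by (auto simp: E_def E'_def vfst_vsum[OF sub] submodD)
  have sE: "vsnd m (E u) = smul hf (vadd (vfst m u) (smul (- im) (vsnd m u)))"
     "vsnd m (E' u) = smul im (vadd (vsnd m u) (smul (- hf) (vfst m u)))" for u
    by (simp_all add: E_def E'_def)
  have eqI: "u = v" if "vfst m u = vfst m v" "vsnd m u = vsnd m v" for u v :: "'r vec"
    using vsum_split[of u m] vsum_split[of v m] that by simp
  have inv: "E' (E u) = u" "E (E' u) = u" if u: "u \<in> ?O" for u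
  proof -
    have 1: "hf * (a + im * b) + hf * (a - im * b) = hf * a + hf * a"
      "im * (hf * (a - im * b) - hf * (a + im * b)) = hf * b + hf * b"
      "hf * a + b + im * (im * (b - hf * a)) = hf * a + hf * a"
      "hf * (hf * a + b - im * (im * (b - hf * a))) = hf * b + hf * b" for a b
      by (simp_all add: algebra_simps im i)
    show "E' (E u) = u"
      by (rule eqI) (simp_all add: fE sE EO u vadd_def smul_def 1 h)
    show "E (E' u) = u"
      by (rule eqI) (simp_all add: fE sE EO u vadd_def smul_def 1 h)
  qed
  have "bij_betw E ?O ?O"
    by (rule bij_betw_byWitness[where f' = E']) (use inv EO in auto)
  moreover have "lin_map ?O E"
    unfolding lin_map_def E_def
    by (simp add: vsum_lin vfst_lin vsnd_lin) 
      (simp add: vadd_def smul_def algebra_simps)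
  moreover have "hform m g (E u) (E v) = oform m g g u v"
    if g: "altform P g" and u: "u \<in> ?O" and v: "v \<in> ?O" for g u v
  proof -
    note alt = altformD[OF g]
    let ?s = "vfst m u" and ?r = "vsnd m u" and ?s' = "vfst m v" and ?r' = "vsnd m v"
    have "hform m g (E u) (E v) = (hf * g ?s ?s' + hf * g ?s ?s') - im * (im * (hf * g ?r ?r' + hf * g ?r ?r'))"
      using mem[OF u] mem[OF v] sub
      by (simp add: hform_def fE sE u v alt submodD algebra_simps)
    also have "\<dots> = g ?s ?s' + g ?r ?r'" by (simp only: h i diff_minus_eq_add)
    finally show ?thesis by (simp add: oform_def)
  qed
  ultimately show thesis by (rule that)
qed

lemma altform_hform:
  fixes hf im :: "'r::comm_ring_1" and P :: "'r vec set"
  assumes P: "fgproj m P" and hf: "2 * hf = 1" and im: "im * im = - 1" and g: "altform P g"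
  shows "altform (osum m P P) (hform m g)"
proof -
  note sub = fgproj_submod[OF P] and subO = submod_osum[OF fgproj_submod[OF P] fgproj_submod[OF P]]
  obtain E where E: "bij_betw E (osum m P P) (osum m P P)" "lin_map (osum m P P) E"
    "\<And>g u v. altform P g \<Longrightarrow> u \<in> osum m P P \<Longrightarrow> v \<in> osum m P P \<Longrightarrow>
      hform m g (E u) (E v) = oform m g g u v"
    using hform_isometry[OF assms(1-3)] by blast
  let ?i = "inv_into (osum m P P) E"
  have b': "bij_betw ?i (osum m P P) (osum m P P)" using E(1) by (rule bij_betw_inv_into)
  have "altform (osum m P P) (pull ?i (oform m g g))"
    by (rule altform_pull[OF subO b' lin_map_inv_into[OF subO E(1,2)] altform_osum[OF sub sub g g]])
  then show ?thesis
  proof (rule altform_cong[OF subO])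
    fix x y assume "x \<in> osum m P P" "y \<in> osum m P P"
    then show "hform m g x y = pull ?i (oform m g g) x y"
      using E(3)[OF g, of "?i x" "?i y"] bij_betw_apply[OF b'] bij_betw_inv_into_right[OF E(1)]
      by (simp add: pull_def)
  qed
qed

text \<open>The map \<open>E\<close> does not depend on the form, so it is an isometry for both
  forms of the triple at once.\<close>

lemma cl_hform:
  fixes hf im :: "'r::comm_ring_1" and P :: "'r vec set"
  assumes P: "fgproj m P" and hf: "2 * hf = 1" and im: "im * im = - 1"
    and g: "altform P g" and f: "altform P f"
  shows "delta (m + m, osum m P P, hform m g, hform m f) \<approx> delta (m, P, g, f) + delta (m, P, g, f)"
proof -
  note sub = fgproj_submod[OF P]
  obtain E where E: "bij_betw E (osum m P P) (osum m P P)" "lin_map (osum m P P) E"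
    "\<And>g u v. altform P g \<Longrightarrow> u \<in> osum m P P \<Longrightarrow> v \<in> osum m P P \<Longrightarrow>
      hform m g (E u) (E v) = oform m g g u v"
    using hform_isometry[OF assms(1-3)] by blast
  have "delta (tsum (m, P, g, f) (m, P, g, f)) \<approx> delta (m + m, osum m P P, hform m g, hform m f)"
    using P g f altform_hform[OF P hf im] altform_osum[OF sub sub] fgproj_osum[OF P P] E
    by (auto intro!: cl_iso[where h = E])
  from veq_sym[OF this] cl_sum[of "(m, P, g, f)" "(m, P, g, f)"] show ?thesis
    using P g f by (auto intro: veq_trans)
qed

section \<open>The forms attached to unimodular elements\<close>

definition wvec :: "nat \<Rightarrow> 'r::comm_ring_1 vec \<Rightarrow> 'r \<Rightarrow> 'r \<Rightarrow> 'r vec" where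
  "wvec m p x y = vsum m p (\<lambda>i. if i = 0 then x else if i = 1 then y else 0)"

lemma wvec_lin: "vadd (wvec m p x y) (wvec m p' x' y') = wvec m (vadd p p') (x + x') (y + y')"
  "smul c (wvec m p x y) = wvec m (smul c p) (c * x) (c * y)"
  by (auto simp: wvec_def vsum_def vadd_def smul_def)

lemma wvec_vzero: "wvec m vzero 0 0 = vzero"
  by (auto simp: wvec_def vsum_def vzero_def)

lemma wvec_apply [simp]: "wvec m p x y m = x" "wvec m p x y (Suc m) = y"
  by (simp_all add: wvec_def vsum_def)

lemma wvec_cong: "p = p' \<Longrightarrow> x = x' \<Longrightarrow> y = y' \<Longrightarrow> wvec m p x y = wvec m p' x' y'"
  by simp

text \<open>Only the restriction \<open>a0\<close> is fixed; the value \<open>e\<close> on the free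
  summand and the section \<open>(v, b)\<close> stay variable.\<close>

locale vaserstein = det_plane m P w hf
  for m :: nat and P :: "'r::comm_ring_1 vec set" and w :: "nat \<Rightarrow> nat \<Rightarrow> 'r" and hf :: 'r +
  fixes im :: 'r and a0 :: "'r vec \<Rightarrow> 'r"
  assumes im: "im * im = - 1" and a0: "lin_on P a0"
begin

definition u :: "'r vec" where
  "u = (SOME x. x \<in> P \<and> (\<forall>y\<in>P. \<chi> x y = a0 y))"

lemma u: "u \<in> P" "y \<in> P \<Longrightarrow> \<chi> u y = a0 y"
proof -
  have "\<exists>x. x \<in> P \<and> (\<forall>y\<in>P. \<chi> x y = a0 y)"
    using nondeg_ex[OF altform_chi a0] by blast
  from someI_ex[OF this] show "u \<in> P" "y \<in> P \<Longrightarrow> \<chi> u y = a0 y" by (auto simp: u_def)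
qed

lemma chi_u: "y \<in> P \<Longrightarrow> \<chi> y u = - a0 y"
  using chi_skew[of y u] u by simp

lemma chi_diag: "x \<in> P \<Longrightarrow> \<chi> x x = 0"
  by (rule theta_form_diag[OF w])

lemma a0_u: "a0 u = 0"
  using u chi_diag by metis

lemmas a0_lin = lin_onD[OF a0]

text \<open>Together with the equation of a section, this relation accounts for every later identity
  between forms.\<close>

lemma plucker:
  assumes "v \<in> P" "p \<in> P" "q \<in> P"
  shows "a0 v * \<chi> p q = a0 p * \<chi> v q - \<chi> v p * a0 q"
  using lin_on_cyc[OF a0 assms(2,3,1)] chi_skew[OF assms(3,1)] by (simp add: add_eq_0_iff algebra_simps)

definition W :: "'r vec set" where "W = osum m P (vecs 2)"

definition mm :: nat where "mm = m + 2"

lemma W: "fgproj mm W"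
  unfolding W_def mm_def by (rule fgproj_osum[OF P fgproj_vecs])

lemma W_sub: "submod mm W"
  using W by (rule fgproj_submod)

lemma wvec_mem: "p \<in> P \<Longrightarrow> wvec m p x y \<in> W"
  unfolding W_def wvec_def by (rule osumI) (auto simp: vecs_def)

lemma vfst_wvec: "p \<in> P \<Longrightarrow> vfst m (wvec m p x y) = p"
  unfolding wvec_def by (rule vfst_vsum[OF sub])

lemma W_fst: "s \<in> W \<Longrightarrow> vfst m s \<in> P"
  by (simp add: W_def osum_iff[OF sub])

lemma W_cases:
  assumes "s \<in> W"
  obtains p x y where "p \<in> P" "s = wvec m p x y"
proof -
  have 1: "vfst m s \<in> P" "vsnd m s \<in> vecs 2" using assms by (simp_all add: W_def osum_iff[OF sub])
  have "vsnd m s = (\<lambda>i. if i = 0 then s m else if i = 1 then s (Suc m) else 0)"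
  proof
    fix i
    have "vsnd m s i = 0" if "2 \<le> i" using 1(2) that by (simp add: vecs_def)
    then show "vsnd m s i = (if i = 0 then s m else if i = 1 then s (Suc m) else 0)"
      by (cases "2 \<le> i") (auto simp: vsnd_def less_2_cases_iff not_le)
  qed
  then have "s = wvec m (vfst m s) (s m) (s (Suc m))"
    using vsum_split[of s m] by (simp add: wvec_def)
  then show thesis using 1(1) that by blast
qed

definition \<omega> :: "'r form" where "\<omega> = oform m \<chi> psi2"

lemma omega_wvec: "p \<in> P \<Longrightarrow> q \<in> P \<Longrightarrow>
    \<omega> (wvec m p x y) (wvec m q x' y') = \<chi> p q + (x * y' - y * x')"
  by (simp add: \<omega>_def oform_def vfst_wvec psi2_def) (simp add: wvec_def psi2_def)

lemma altform_omega: "altform W \<omega>"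
  unfolding W_def \<omega>_def
  by (rule altform_osum[OF sub fgproj_submod[OF fgproj_vecs] altform_chi altform_psi2])

text \<open>The second form of the symbol, written out for a section \<open>(v, b)\<close> of
  \<open>(a0, e)\<close>. The section is a parameter because sections for \<open>c\<close> and
  \<open>d\<close> will be derived from one for \<open>c * c * d\<close>.\<close>

definition fm :: "'r \<Rightarrow> 'r \<Rightarrow> 'r vec \<Rightarrow> 'r form" where
  "fm e b v s t = b * \<chi> (vfst m s) (vfst m t) + e * (s m * t (Suc m) - s (Suc m) * t m)
    + (a0 (vfst m s) * t (Suc m) + \<chi> v (vfst m s) * t m)
    - (a0 (vfst m t) * s (Suc m) + \<chi> v (vfst m t) * s m)"

lemma fm_wvec: "p \<in> P \<Longrightarrow> q \<in> P \<Longrightarrow>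
    fm e b v (wvec m p x y) (wvec m q x' y') = b * \<chi> p q + e * (x * y' - y * x')
    + (a0 p * y' + \<chi> v p * x') - (a0 q * y + \<chi> v q * x)"
  by (simp add: fm_def vfst_wvec)

lemma altform_fm:
  assumes v: "v \<in> P" and unit: "e * b + a0 v = 1"
  shows "altform W (fm e b v)"
proof (rule altformI[OF W_sub])
  show "bilin_on W (fm e b v)"
    using v unfolding bilin_on_def lin_on_def fm_def
    by (simp add: W_fst vfst_lin chi_lin a0_lin vadd_apply smul_apply algebra_simps)
  show "fm e b v s s = 0" if "s \<in> W" for s
    using that by (elim W_cases) (simp add: fm_wvec chi_diag)
  fix f assume f: "lin_on W f"
  have "lin_on P (\<lambda>p. f (wvec m p 0 0))"
    using lin_onD[OF f] wvec_lin(1)[of m _ 0 0 _ 0 0] wvec_lin(2)[of _ m _ 0 0] wvec_mem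
    unfolding lin_on_def by (metis add_0 mult_zero_right)
  then obtain z where z: "z \<in> P" "\<forall>p\<in>P. \<chi> z p = f (wvec m p 0 0)"
    using nondeg_ex[OF altform_chi] by meson
  define f1 f2 where "f1 = f (wvec m vzero 1 0)" and "f2 = f (wvec m vzero 0 1)"
  have f_wvec: "f (wvec m p x y) = \<chi> z p + x * f1 + y * f2" if "p \<in> P" for p x y
  proof -
    have "wvec m p x y = vadd (wvec m p 0 0) (vadd (smul x (wvec m vzero 1 0)) (smul y (wvec m vzero 0 1)))"
      by (simp add: wvec_lin vzero_lin)
    then show ?thesis
      using that z submodD[OF W_sub] submodD(3)[OF sub] 
      by (simp add: lin_onD[OF f] wvec_mem f1_def f2_def)
  qed
  \<comment> \<open>This vector follows the pattern of the Pfaffian adjugate of a 4x4 matrix, in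
    which \<open>e\<close> and \<open>b\<close> trade places. Pairing it with \<open>t\<close>
    yields \<open>e * b + a0 v\<close> times \<open>f t\<close>, up to a Pluecker relation.\<close>
  let ?p = "vadd (smul e z) (vadd (smul (- f1) u) (smul f2 v))"
  let ?x = "b * f2 - a0 z" and ?y = "\<chi> v z - b * f1"
  have p: "?p \<in> P" using z u v sub by (simp add: submodD)
  have "fm e b v (wvec m ?p ?x ?y) t = f t" if "t \<in> W" for t
    using that
  proof (rule W_cases)
    fix q x y assume q: "q \<in> P" and t: "t = wvec m q x y"
    have 1: "\<chi> ?p q = e * \<chi> z q - f1 * a0 q + f2 * \<chi> v q"
      "a0 ?p = e * a0 z + f2 * a0 v" "\<chi> v ?p = e * \<chi> v z + f1 * a0 v"
      using z u v q sub by (simp_all add: chi_lin a0_lin submodD chi_u a0_u chi_diag)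
    have "fm e b v (wvec m ?p ?x ?y) t = (e * b + a0 v) * (\<chi> z q + x * f1 + y * f2)
      + (a0 z * \<chi> v q - \<chi> v z * a0 q - a0 v * \<chi> z q)"
      unfolding t fm_wvec[OF p q] 1 by (simp add: algebra_simps)
    then show ?thesis using plucker[OF v z(1) q] unit by (simp add: t f_wvec[OF q])
  qed
  then show "\<exists>x\<in>W. \<forall>y\<in>W. fm e b v x y = f y" using wvec_mem[OF p] by blast
qed

text \<open>The class of the symbol of \<open>(a0, e)\<close>, computed with the section
  \<open>(v, b)\<close>; \<open>Vsym_eq_K\<close> makes the link to \<open>Vsym\<close>.\<close>

definition K :: "'r \<Rightarrow> 'r \<Rightarrow> 'r vec \<Rightarrow> 'r triple \<Rightarrow> int" where
  "K e b v = delta (mm, W, \<omega>, fm e b v)"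

text \<open>Two sections of \<open>(a0, e)\<close> differ by a transvection of \<open>P \<oplus> R\<close>.\<close>
lemma K_section:
  assumes v: "v \<in> P" and unit: "e * b + a0 v = 1" and v': "v' \<in> P" and unit': "e * b' + a0 v' = 1"
  shows "K e b' v' \<approx> K e b v"
proof -
  define z where "z = vadd v' (smul (- 1) v)"
  define c where "c = b' - b"
  have z: "z \<in> P" using v v' sub by (simp add: z_def submodD)
  have v'_eq: "v' = vadd v z" by (simp add: z_def vadd_def smul_def)
  have b'_eq: "b' = b + c" by (simp add: c_def)
  have zc: "a0 z = - (e * c)"
    using unit unit' v v' sub by (simp add: z_def c_def a0_lin submodD algebra_simps)
  define a where "a = (\<lambda>s. a0 (vfst m s) + e * s m)"
  have a_lin: "a (vadd s t) = a s + a t" "a (smul k s) = k * a s" if "s \<in> W" "t \<in> W" for s t k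
    using that by (simp_all add: a_def vfst_lin a0_lin W_fst vadd_apply smul_apply algebra_simps)
  \<comment> \<open>The transvection moves along the difference \<open>(z, c)\<close> of the
    sections, on which \<open>a\<close> vanishes. The map \<open>?\<pi>\<close> projects
    \<open>P \<oplus> R\<close> onto the kernel of \<open>a\<close> along \<open>(v, b)\<close> and
    drops the last coordinate.\<close>
  let ?N = "\<lambda>s. smul (- a s) (wvec m z c 0)"
  let ?\<pi> = "\<lambda>s. wvec m (vadd (vfst m s) (smul (- a s) v)) (s m - a s * b) 0"
  have az: "a (wvec m z c 0) = 0" using z by (simp add: a_def vfst_wvec zc)
  have av: "a (wvec m (vadd p (smul (- k) v)) (x - k * b) y) = a (wvec m p x 0) - k" if "p \<in> P" for p x y k
  proof -
    have "a (wvec m (vadd p (smul (- k) v)) (x - k * b) y) = a0 p + e * x - k * (e * b + a0 v)"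
      using that v sub by (simp add: a_def vfst_wvec a0_lin submodD algebra_simps)
    then show ?thesis using that unit by (simp add: a_def vfst_wvec)
  qed
  have ay: "a (wvec m p x y) = a (wvec m p x 0)" if "p \<in> P" for p x y
    using that by (simp add: a_def vfst_wvec)
  interpret un: unipotent mm W hf ?N ?\<pi>
  proof
    show "fgproj mm W" by (rule W)
    show "2 * hf = 1" by (rule hf)
    show "lin_map W ?N"
      unfolding lin_map_def by (simp add: a_lin) (simp add: vadd_def smul_def algebra_simps)
    show "lin_map W ?\<pi>"
      unfolding lin_map_def
      by (simp add: a_lin vfst_lin vadd_apply smul_apply wvec_lin; intro conjI ballI allI wvec_cong)
        (simp_all add: vadd_def smul_def algebra_simps)
    fix s assume s: "s \<in> W"
    show N: "?N s \<in> W" using s z W_sub by (simp add: submodD wvec_mem)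
    have p: "vadd (vfst m s) (smul (- a s) v) \<in> P" using s v sub by (simp add: submodD W_fst)
    then show "?\<pi> s \<in> W" by (rule wvec_mem)
    have "a (?\<pi> s) = 0"
      using s by (elim W_cases) (simp add: av vfst_wvec, simp add: ay[symmetric])
    then show "?N (?\<pi> s) = vzero" "?\<pi> (?\<pi> s) = ?\<pi> s"
      using p by (simp_all add: vfst_wvec) (simp_all add: smul_def vzero_def vadd_def)
    have aN: "a (?N s) = 0" using a_lin(2)[OF wvec_mem[OF z] wvec_mem[OF z]] az by simp
    show "?\<pi> (?N s) = ?N s"
      unfolding aN using z by (simp add: wvec_lin vfst_wvec submodD[OF sub]) (simp add: vadd_def smul_def)
  qed
  have form: "fm e b' v' s t = fm e b v (vadd s (?N s)) (vadd t (?N t))" if s: "s \<in> W" and t: "t \<in> W" for s t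
    using s
  proof (rule W_cases)
    fix p x y assume p: "p \<in> P" and s: "s = wvec m p x y"
    show ?thesis using t
    proof (rule W_cases)
      fix q x' y' assume q: "q \<in> P" and t: "t = wvec m q x' y'"
      define k l where "k = a0 p + e * x" and "l = a0 q + e * x'"
      have as: "a s = k" "a t = l" using p q by (simp_all add: s t a_def vfst_wvec k_def l_def)
      have mem: "vadd p (smul (- k) z) \<in> P" "vadd q (smul (- l) z) \<in> P"
        using p q z sub by (simp_all add: submodD)
      have eq: "vadd s (?N s) = wvec m (vadd p (smul (- k) z)) (x - k * c) y"
        "vadd t (?N t) = wvec m (vadd q (smul (- l) z)) (x' - l * c) y'"
        unfolding as unfolding s t wvec_lin by simp_all
      have lhs: "fm e b' v' s t = (b + c) * \<chi> p q + e * (x * y' - y * x')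
          + (a0 p * y' + (\<chi> v p + \<chi> z p) * x') - (a0 q * y + (\<chi> v q + \<chi> z q) * x)"
        using p q v z unfolding s t v'_eq b'_eq by (simp add: fm_wvec chi_lin)
      have rhs: "fm e b v (vadd s (?N s)) (vadd t (?N t))
         = b * (\<chi> p q + l * \<chi> z p - k * \<chi> z q) + e * ((x - k * c) * y' - y * (x' - l * c))
          + ((a0 p + k * e * c) * y' + (\<chi> v p - k * \<chi> v z) * (x' - l * c))
          - ((a0 q + l * e * c) * y + (\<chi> v q - l * \<chi> v z) * (x - k * c))"
        unfolding eq fm_wvec[OF mem]
        using p q v z sub chi_skew[OF p z]
        by (simp add: chi_lin a0_lin submodD zc chi_diag algebra_simps)
      note pl = plucker[OF v p q] plucker[OF v z p] plucker[OF v z q] plucker[OF z p q]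
      \<comment> \<open>The difference is a combination of the section equation and the relations
        \<open>pl\<close>, with \<open>a0 z\<close> replaced by \<open>- (e * c)\<close>.\<close>
      have "fm e b v (vadd s (?N s)) (vadd t (?N t)) - fm e b' v' s t
        = (e * b + a0 v - 1) * (c * \<chi> p q + x' * \<chi> z p - x * \<chi> z q)
          + c * (a0 p * \<chi> v q - \<chi> v p * a0 q - a0 v * \<chi> p q)
          + x' * (- (e * c) * \<chi> v p - \<chi> v z * a0 p - a0 v * \<chi> z p)
          - x * (- (e * c) * \<chi> v q - \<chi> v z * a0 q - a0 v * \<chi> z q)
          - b * (a0 p * \<chi> z q - \<chi> z p * a0 q - - (e * c) * \<chi> p q)"
        unfolding lhs rhs k_def l_def by (simp add: algebra_simps)
      also have "\<dots> = 0" using pl[unfolded zc] unit by simp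
      finally show ?thesis by simp
    qed
  qed
  show ?thesis
    unfolding K_def by (rule un.cl_eq[OF altform_omega altform_fm[OF v unit] form])
qed

text \<open>For \<open>e = 1\<close> the section may be taken to be \<open>(vzero, 1)\<close>. The
  form is then \<open>\<omega>\<close> plus cross terms in \<open>a0\<close>, and the transvection
  by \<open>a0\<close> along the first free coordinate absorbs these.\<close>

lemma K_1:
  assumes v: "v \<in> P" and unit: "b + a0 v = 1"
  shows "K 1 b v \<approx> 0"
proof -
  have z: "vzero \<in> P" using sub by (rule submodD)
  let ?N = "\<lambda>s. wvec m vzero (a0 (vfst m s)) 0" and ?\<pi> = "\<lambda>s. wvec m vzero (s m) 0"
  have a0z: "a0 vzero = 0" by (rule lin_on_vzero[OF sub a0])
  have chiz: "\<chi> vzero p = 0" if "p \<in> P" for p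
    using lin_on_vzero[OF sub, of "\<lambda>x. \<chi> x p"] bilin_theta_form[OF sub w] that by (auto simp: bilin_on_def)
  interpret un: unipotent mm W hf ?N ?\<pi>
  proof
    show "fgproj mm W" by (rule W)
    show "2 * hf = 1" by (rule hf)
    show "lin_map W ?N" "lin_map W ?\<pi>"
      unfolding lin_map_def
      by (simp_all add: vfst_lin a0_lin W_fst vadd_apply smul_apply wvec_lin vzero_lin)
  qed (use z in \<open>auto simp: wvec_mem vfst_wvec a0z wvec_vzero\<close>)
  have "K 1 b v \<approx> K 1 1 vzero"
    by (rule K_section) (use z v unit a0z in auto)
  also have "K 1 1 vzero \<approx> delta (mm, W, \<omega>, \<omega>)"
    unfolding K_def
  proof (rule un.cl_eq[OF altform_omega altform_omega])
    fix s t assume "s \<in> W" "t \<in> W"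
    then show "fm 1 1 vzero s t = \<omega> (vadd s (?N s)) (vadd t (?N t))"
      by (elim W_cases) (simp add: vfst_wvec wvec_lin vzero_lin omega_wvec fm_wvec chiz algebra_simps)
  qed
  also have "\<dots> \<approx> 0" by (rule cl_same[OF W altform_omega])
  finally show ?thesis .
qed

end

section \<open>The relation between \<open>c\<^sup>2 d\<close>, \<open>d\<close> and \<open>c\<close>\<close>

context vaserstein
begin

section \<open>Three copies of \<open>P \<oplus> R^2\<close> and their permutations\<close>

abbreviation sl1 :: "'r vec \<Rightarrow> 'r vec" where "sl1 z \<equiv> vfst mm z"
abbreviation sl2 :: "'r vec \<Rightarrow> 'r vec" where "sl2 z \<equiv> vfst mm (vsnd mm z)"
abbreviation sl3 :: "'r vec \<Rightarrow> 'r vec" where "sl3 z \<equiv> vsnd mm (vsnd mm z)"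

definition t3 :: "'r vec \<Rightarrow> 'r vec \<Rightarrow> 'r vec \<Rightarrow> 'r vec" where
  "t3 p q r = vsum mm p (vsum mm q r)"

definition M :: "'r vec set" where "M = osum mm W (osum mm W W)"

lemma WW: "fgproj (mm + mm) (osum mm W W)"
  by (rule fgproj_osum[OF W W])

lemma M: "fgproj (mm + (mm + mm)) M"
  unfolding M_def by (rule fgproj_osum[OF W WW])

lemma M_iff: "z \<in> M \<longleftrightarrow> sl1 z \<in> W \<and> sl2 z \<in> W \<and> sl3 z \<in> W"
  by (simp add: M_def osum_iff[OF W_sub])

lemma t3_mem: "p \<in> W \<Longrightarrow> q \<in> W \<Longrightarrow> r \<in> W \<Longrightarrow> t3 p q r \<in> M"
  by (simp add: M_def t3_def osumI)

lemma sl_t3: "p \<in> W \<Longrightarrow> sl1 (t3 p q r) = p" "q \<in> W \<Longrightarrow> sl2 (t3 p q r) = q" "sl3 (t3 p q r) = r"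
  by (simp_all add: t3_def vfst_vsum[OF W_sub])

lemma t3_lin: "vadd (t3 p q r) (t3 p' q' r') = t3 (vadd p p') (vadd q q') (vadd r r')"
  "smul c (t3 p q r) = t3 (smul c p) (smul c q) (smul c r)"
  by (simp_all add: t3_def vsum_lin)

lemma t3_vzero: "t3 vzero vzero vzero = vzero"
  by (auto simp: t3_def vsum_def vzero_def)

lemma t3_cong: "p = p' \<Longrightarrow> q = q' \<Longrightarrow> r = r' \<Longrightarrow> t3 p q r = t3 p' q' r'"
  by simp

lemma t3_split: "z = t3 (sl1 z) (sl2 z) (sl3 z)"
  by (simp add: t3_def flip: vsum_split)

lemma M_cases:
  assumes "z \<in> M"
  obtains p q r where "p \<in> W" "q \<in> W" "r \<in> W" "z = t3 p q r"
  using assms t3_split[of z] M_iff by blast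

lemma M_wvec_cases:
  assumes "z \<in> M"
  obtains p x y p' x' y' p'' x'' y'' where "p \<in> P" "p' \<in> P" "p'' \<in> P" 
    "z = t3 (wvec m p x y) (wvec m p' x' y') (wvec m p'' x'' y'')"
  using assms by (elim M_cases W_cases) blast

lemma vzero_P: "vzero \<in> P" 
  using sub by (rule submodD)

lemma vzero_W: "vzero \<in> W" 
  using W_sub by (rule submodD)

lemma a0_vzero: "a0 vzero = 0"
  by (rule lin_on_vzero[OF sub a0])

lemma chi_vzero: "p \<in> P \<Longrightarrow> \<chi> p vzero = 0" "p \<in> P \<Longrightarrow> \<chi> vzero p = 0"
  using lin_on_vzero[OF sub, of "\<chi> p"] bilin_theta_form[OF sub w] chi_skew[of vzero p] vzero_P 
  by (auto simp: bilin_on_def)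

lemma vzero_apply: "(vzero :: 'r vec) i = 0"
  by (simp add: vzero_def)

lemma vfst_vzero: "vfst m (vzero :: 'r vec) = vzero"
  using vfst_wvec[OF vzero_P, of 0 0] by (simp add: wvec_vzero)

text \<open>The \<open>P\<close>-components and the \<open>R^2\<close>-components rotate in opposite
  directions. The first slot thus receives the \<open>P\<close>-part of \<open>sl2\<close> and the
  \<open>R^2\<close>-part of \<open>sl3\<close>, the two parts that carry \<open>Fe\<close> in
  \<open>\<Psi>\<close>.\<close>

definition cyc3 :: "'r vec \<Rightarrow> 'r vec" where
  "cyc3 z = t3 (wvec m (vfst m (sl2 z)) (sl3 z m) (sl3 z (Suc m)))
     (wvec m (vfst m (sl3 z)) (sl1 z m) (sl1 z (Suc m))) (wvec m (vfst m (sl1 z)) (sl2 z m) (sl2 z (Suc m)))"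

definition cyc3' :: "'r vec \<Rightarrow> 'r vec" where
  "cyc3' z = t3 (wvec m (vfst m (sl3 z)) (sl2 z m) (sl2 z (Suc m)))
     (wvec m (vfst m (sl1 z)) (sl3 z m) (sl3 z (Suc m))) (wvec m (vfst m (sl2 z)) (sl1 z m) (sl1 z (Suc m)))"

definition swap :: "'r vec \<Rightarrow> 'r vec" where
  "swap z = t3 (sl1 z) (sl3 z) (sl2 z)"

lemma aut_cyc3: "aut M cyc3"
proof (rule autI[where \<psi> = cyc3'])
  show "lin_map M cyc3"
    unfolding lin_map_def cyc3_def
    by (simp add: vfst_lin vsnd_lin vadd_apply smul_apply wvec_lin t3_lin)
  fix z assume "z \<in> M"
  then obtain p x y p' x' y' p'' x'' y'' where z: "p \<in> P" "p' \<in> P" "p'' \<in> P" 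
    "z = t3 (wvec m p x y) (wvec m p' x' y') (wvec m p'' x'' y'')" by (rule M_wvec_cases)
  show "cyc3 z \<in> M" "cyc3' z \<in> M" "cyc3' (cyc3 z) = z" "cyc3 (cyc3' z) = z"
    using z(1-3) unfolding z(4) by (simp_all add: cyc3_def cyc3'_def sl_t3 wvec_mem vfst_wvec t3_mem)
qed

lemma aut_swap: "aut M swap"
proof (rule autI[where \<psi> = swap])
  show "lin_map M swap"
    unfolding lin_map_def swap_def by (simp add: vfst_lin vsnd_lin t3_lin)
  fix z assume "z \<in> M"
  then obtain p q r where "p \<in> W" "q \<in> W" "r \<in> W" "z = t3 p q r" by (rule M_cases)
  then show "swap z \<in> M" "swap (swap z) = z" "swap z \<in> M" "swap (swap z) = z"
    by (simp_all add: swap_def sl_t3 t3_mem)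
qed

text \<open>\<open>cyc3\<close> has order three and is conjugate to its inverse, hence to its square.\<close>
lemma swap_cyc3: "z \<in> M \<Longrightarrow> swap (cyc3 z) = cyc3 (cyc3 (swap z))"
  by (elim M_wvec_cases) (simp add: cyc3_def swap_def sl_t3 wvec_mem vfst_wvec)

end

text \<open>One section \<open>(v, b)\<close> of \<open>(a0, c * c * d)\<close> also gives the
  sections \<open>(v, b * c * d)\<close> of \<open>(a0, c)\<close> and \<open>(v, b * c * c)\<close>
  of \<open>(a0, d)\<close>.\<close>

locale vaserstein_step = vaserstein m P w hf im a0
  for m :: nat and P :: "'r::comm_ring_1 vec set" and w :: "nat \<Rightarrow> nat \<Rightarrow> 'r" and hf im :: 'r 
    and a0 :: "'r vec \<Rightarrow> 'r" +
  fixes b c d :: 'r and v :: "'r vec"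
  assumes v: "v \<in> P" and unit: "c * c * d * b + a0 v = 1"
begin

abbreviation "Fc \<equiv> fm c (b * c * d) v"
abbreviation "Fd \<equiv> fm d (b * c * c) v"
abbreviation "Fe \<equiv> fm (c * c * d) b v"

lemma alt: "altform W Fc" "altform W Fd" "altform W Fe"
  using unit v by (auto intro!: altform_fm simp: mult_ac)

text \<open>For the form \<open>F\<close> over \<open>A\<close> and the coefficient
  \<open>\<tau>\<close> of \<open>t^2\<close>, \<open>X\<close> is \<open>\<tau> \<circ> F\<close>
  and \<open>S\<close> is \<open>\<tau> \<circ> (t - c) F\<close>: the pairings of the basis vector
  1 with itself and with \<open>t - c\<close>.\<close>

definition S :: "'r form" where
  "S s t = s m * t (Suc m) - s (Suc m) * t m - b * c * \<chi> (vfst m s) (vfst m t)"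

definition X :: "'r form" where
  "X s t = b * \<chi> (vfst m s) (vfst m t)"

text \<open>As \<open>Fc\<close> is nondegenerate, \<open>- S\<close> and \<open>- hf * X\<close>
  can be written as \<open>Fc s (T t)\<close> and \<open>Fc s (U t)\<close>. The formulas for
  \<open>T\<close> and \<open>U\<close> come from the explicit inverse in
  \<open>altform_fm\<close>.\<close>

definition T :: "'r vec \<Rightarrow> 'r vec" where
  "T s = wvec m (vadd (smul (b * c * c) (vfst m s)) (vadd (smul (- s (Suc m)) u) (smul (- s m) v)))
     (- (b * c * a0 (vfst m s)) - b * c * d * s m) (b * c * \<chi> v (vfst m s) - b * c * d * s (Suc m))"

definition U :: "'r vec \<Rightarrow> 'r vec" where
  "U s = wvec m (smul (- (b * c * hf)) (vfst m s)) (b * hf * a0 (vfst m s)) (- (b * hf * \<chi> v (vfst m s)))"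

lemma T_lin: "s \<in> W \<Longrightarrow> t \<in> W \<Longrightarrow> T (vadd s t) = vadd (T s) (T t)" "s \<in> W \<Longrightarrow> T (smul k s) = smul k (T s)"
  unfolding T_def using v
  by (simp_all add: vfst_lin vadd_apply smul_apply a0_lin chi_lin W_fst wvec_lin)
    (intro wvec_cong; simp add: vadd_def smul_def algebra_simps)+

lemma U_lin: "s \<in> W \<Longrightarrow> t \<in> W \<Longrightarrow> U (vadd s t) = vadd (U s) (U t)" "s \<in> W \<Longrightarrow> U (smul k s) = smul k (U s)"
  unfolding U_def using v
  by (simp_all add: vfst_lin vadd_apply smul_apply a0_lin chi_lin W_fst wvec_lin)
    (intro wvec_cong; simp add: vadd_def smul_def algebra_simps)+

lemma TU_mem: "s \<in> W \<Longrightarrow> T s \<in> W" "s \<in> W \<Longrightarrow> U s \<in> W"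
  unfolding T_def U_def using v u(1) sub by (simp_all add: wvec_mem submodD W_fst)

lemma TU_vzero: "T vzero = vzero" "U vzero = vzero"
  unfolding T_def U_def 
  by (simp_all add: vfst_vzero vzero_apply a0_vzero chi_vzero v)
    (simp_all add: vzero_lin wvec_vzero)

lemma Fc_T:
  assumes "s \<in> W" "t \<in> W"
  shows "Fc s (T t) = - S s t"
  using assms(1)
proof (rule W_cases)
  fix p x y assume p: "p \<in> P" and s: "s = wvec m p x y"
  show ?thesis using assms(2)
  proof (rule W_cases)
    fix q x' y' assume q: "q \<in> P" and t: "t = wvec m q x' y'"
    let ?q = "vadd (smul (b * c * c) q) (vadd (smul (- y') u) (smul (- x') v))"
    have mem: "?q \<in> P" using v u(1) q sub by (simp add: submodD)
    have 1: "\<chi> p ?q = b * c * c * \<chi> p q + y' * a0 p + x' * \<chi> v p"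
      "a0 ?q = b * c * c * a0 q - x' * a0 v" "\<chi> v ?q = b * c * c * \<chi> v q + y' * a0 v"
      using p q v u sub chi_skew[OF p v]
      by (simp_all add: chi_lin a0_lin submodD chi_u a0_u chi_diag)
    have T: "T t = wvec m ?q (- (b * c * a0 q) - b * c * d * x') (b * c * \<chi> v q - b * c * d * y')"
      using q by (simp add: T_def t vfst_wvec)
    have "Fc s (T t) = - ((x * y' - y * x') * (c * c * d * b + a0 v) - b * c * \<chi> p q * (c * c * d * b + a0 v))
       + b * c * (a0 p * \<chi> v q - \<chi> v p * a0 q - a0 v * \<chi> p q)"
      unfolding s T fm_wvec[OF p mem] 1 by (simp add: algebra_simps)
    then show ?thesis
      using plucker[OF v p q] unit p q by (simp add: s t S_def vfst_wvec)
  qed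
qed

lemma Fc_U:
  assumes "s \<in> W" "t \<in> W"
  shows "Fc s (U t) = - (hf * X s t)"
  using assms(1)
proof (rule W_cases)
  fix p x y assume p: "p \<in> P" and s: "s = wvec m p x y"
  show ?thesis using assms(2)
  proof (rule W_cases)
    fix q x' y' assume q: "q \<in> P" and t: "t = wvec m q x' y'"
    have mem: "smul (- (b * c * hf)) q \<in> P" using q sub by (simp add: submodD)
    have U: "U t = wvec m (smul (- (b * c * hf)) q) (b * hf * a0 q) (- (b * hf * \<chi> v q))"
      using q by (simp add: U_def t vfst_wvec)
    have "Fc s (U t) = - (b * hf * \<chi> p q * (c * c * d * b + a0 v))
       - b * hf * (a0 p * \<chi> v q - \<chi> v p * a0 q - a0 v * \<chi> p q)"
      unfolding s U fm_wvec[OF p mem] using p q v by (simp add: chi_lin a0_lin algebra_simps)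
    then show ?thesis
      using plucker[OF v p q] unit p q by (simp add: s t X_def vfst_wvec mult_ac)
  qed
qed

lemma SX_skew: "s \<in> W \<Longrightarrow> t \<in> W \<Longrightarrow> S s t = - S t s" "s \<in> W \<Longrightarrow> t \<in> W \<Longrightarrow> X s t = - X t s"
  using chi_skew[OF W_fst W_fst, of s t] by (simp_all add: S_def X_def algebra_simps)

text \<open>\<open>\<tau> \<circ> F\<close> for the form \<open>F\<close> over \<open>A = R[t]/((t - c)\<^sup>2 (t - d))\<close> belonging to \<open>(a0, t)\<close>, where
  \<open>\<tau>\<close> is the coefficient of \<open>t\<^sup>2\<close>. The slots \<open>sl2, sl1, sl3\<close> (in this order) refer to the
  basis \<open>1, t - c, (t - c)(t - d)\<close>.\<close>
definition \<Phi> :: "'r form" where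
  "\<Phi> z z' = Fd (sl1 z) (sl1 z') + Fc (sl2 z) (sl3 z') + Fc (sl3 z) (sl2 z')
     + S (sl2 z) (sl1 z') + S (sl1 z) (sl2 z') + X (sl2 z) (sl2 z')"

text \<open>Completing the square: \<open>sl3\<close> is isotropic for \<open>\<Phi>\<close> and
  pairs only with \<open>sl2\<close>, through \<open>Fc\<close>, so a shift of \<open>sl3\<close> by
  \<open>T\<close> and \<open>U\<close> cancels the terms \<open>S\<close> and
  \<open>X\<close>.\<close>

definition N\<alpha> :: "'r vec \<Rightarrow> 'r vec" where
  "N\<alpha> z = t3 vzero vzero (vadd (T (sl1 z)) (U (sl2 z)))"

text \<open>Here, as for \<open>\<beta>\<close> and \<open>\<gamma>\<close> below, the projection
  keeps exactly the coordinates that \<open>N\<close> writes, and \<open>N\<close> reads none of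
  them.\<close>

definition \<pi>\<alpha> :: "'r vec \<Rightarrow> 'r vec" where
  "\<pi>\<alpha> z = t3 vzero vzero (sl3 z)"

text \<open>Change to the basis \<open>1, t, t^2 - (c + d) t\<close> on \<open>P\<close>-components
  (slots \<open>sl2, sl1, sl3\<close>) and to
  \<open>1, t - c, t^2 - (2 c + d) t + c^2 + 2 c d\<close> on \<open>R^2\<close>-components; the
  last element times \<open>t\<close> is the norm \<open>c^2 d\<close>. The terms in
  \<open>a0\<close> and \<open>\<chi> v\<close> clear the remaining cross terms.\<close>

definition N\<beta> :: "'r vec \<Rightarrow> 'r vec" where
  "N\<beta> z = t3 (wvec m vzero (- a0 (vfst m (sl3 z)) - c * sl3 z m) (\<chi> v (vfst m (sl3 z)) - c * sl3 z (Suc m)))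
     (wvec m (vadd (smul c (vfst m (sl1 z))) (smul (- (c * d)) (vfst m (sl3 z))))
       (d * a0 (vfst m (sl3 z)) - a0 (vfst m (sl1 z)) + c * d * sl3 z m)
       (\<chi> v (vfst m (sl1 z)) - d * \<chi> v (vfst m (sl3 z)) + c * d * sl3 z (Suc m)))
     vzero"

definition \<pi>\<beta> :: "'r vec \<Rightarrow> 'r vec" where
  "\<pi>\<beta> z = t3 (wvec m vzero (sl1 z m) (sl1 z (Suc m))) (sl2 z) vzero"

text \<open>Half-shifts that remove the two self-pairings with factor \<open>d\<close> from
  \<open>\<Psi>\<close>.\<close>

definition N\<gamma> :: "'r vec \<Rightarrow> 'r vec" where
  "N\<gamma> z = t3 (wvec m (smul (d * hf) (vfst m (sl3 z))) 0 0)
     (wvec m vzero (- (d * hf * sl1 z m)) (- (d * hf * sl1 z (Suc m)))) vzero"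

definition \<pi>\<gamma> :: "'r vec \<Rightarrow> 'r vec" where
  "\<pi>\<gamma> z = t3 (wvec m (vfst m (sl1 z)) 0 0) (wvec m vzero (sl2 z m) (sl2 z (Suc m))) vzero"

text \<open>The form \<open>\<Phi>\<close> in the new basis. Besides \<open>Fe\<close>, it pairs
  \<open>sl1\<close> with \<open>sl3\<close> on \<open>P\<close>-parts and \<open>sl1\<close> with
  \<open>sl2\<close> on \<open>R^2\<close>-parts, up to self-pairings of \<open>sl3\<close> and
  \<open>sl1\<close>.\<close>

definition \<Psi> :: "'r form" where
  "\<Psi> z z' = Fe (wvec m (vfst m (sl2 z)) (sl3 z m) (sl3 z (Suc m))) 
       (wvec m (vfst m (sl2 z')) (sl3 z' m) (sl3 z' (Suc m)))
     + \<chi> (vfst m (sl1 z)) (vfst m (sl3 z')) + \<chi> (vfst m (sl3 z)) (vfst m (sl1 z'))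
     - d * \<chi> (vfst m (sl3 z)) (vfst m (sl3 z'))
     + (sl1 z m * sl2 z' (Suc m) - sl1 z (Suc m) * sl2 z' m)
     + (sl2 z m * sl1 z' (Suc m) - sl2 z (Suc m) * sl1 z' m)
     + d * (sl1 z m * sl1 z' (Suc m) - sl1 z (Suc m) * sl1 z' m)"

section \<open>The three changes of basis\<close>

lemma unipotent_\<alpha>: "unipotent (mm + (mm + mm)) M hf N\<alpha> \<pi>\<alpha>"
proof
  show "fgproj (mm + (mm + mm)) M" "2 * hf = 1" by (rule M, rule hf)
  show "lin_map M N\<alpha>"
  proof (rule lin_mapI)
    fix z z' k assume "z \<in> M" "z' \<in> M"
    then have W: "sl1 z \<in> W" "sl2 z \<in> W" "sl1 z' \<in> W" "sl2 z' \<in> W" by (simp_all add: M_iff)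
    show "N\<alpha> (vadd z z') = vadd (N\<alpha> z) (N\<alpha> z')"
      unfolding N\<alpha>_def vfst_lin vsnd_lin t3_lin vzero_lin T_lin(1)[OF W(1,3)] U_lin(1)[OF W(2,4)]
      by (rule t3_cong) (simp_all add: vadd_def algebra_simps)
  next
    fix z k assume "z \<in> M"
    then have W: "sl1 z \<in> W" "sl2 z \<in> W" by (simp_all add: M_iff)
    show "N\<alpha> (smul k z) = smul k (N\<alpha> z)"
      unfolding N\<alpha>_def vfst_lin vsnd_lin t3_lin vzero_lin T_lin(2)[OF W(1)] U_lin(2)[OF W(2)]
      by (rule t3_cong) (simp_all add: vadd_def smul_def algebra_simps)
  qed
  show "lin_map M \<pi>\<alpha>"
    by (rule lin_mapI) (simp_all add: \<pi>\<alpha>_def vsnd_lin t3_lin vzero_lin)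
  fix z assume "z \<in> M"
  then have W: "sl1 z \<in> W" "sl2 z \<in> W" "sl3 z \<in> W" by (simp_all add: M_iff)
  then have "vadd (T (sl1 z)) (U (sl2 z)) \<in> W" by (intro submodD[OF W_sub] TU_mem)
  then show "N\<alpha> z \<in> M" "\<pi>\<alpha> z \<in> M" "\<pi>\<alpha> (\<pi>\<alpha> z) = \<pi>\<alpha> z" "\<pi>\<alpha> (N\<alpha> z) = N\<alpha> z" "N\<alpha> (\<pi>\<alpha> z) = vzero"
    using W by (simp_all add: N\<alpha>_def \<pi>\<alpha>_def sl_t3 vzero_W t3_mem TU_vzero vzero_lin t3_vzero)
qed

lemma unipotent_\<beta>: "unipotent (mm + (mm + mm)) M hf N\<beta> \<pi>\<beta>"
proof
  show "fgproj (mm + (mm + mm)) M" "2 * hf = 1" by (rule M, rule hf)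
  show "lin_map M N\<beta>"
  proof (rule lin_mapI)
    fix z z' k assume "z \<in> M" "z' \<in> M"
    then have "vfst m (sl1 z) \<in> P" "vfst m (sl3 z) \<in> P" "vfst m (sl1 z') \<in> P" "vfst m (sl3 z') \<in> P"
      by (simp_all add: M_iff W_fst)
    then show "N\<beta> (vadd z z') = vadd (N\<beta> z) (N\<beta> z')"
      using v
      by (simp only: N\<beta>_def vfst_lin vsnd_lin t3_lin wvec_lin(1) vzero_lin vadd_apply; intro t3_cong wvec_cong)
        (simp_all add: a0_lin chi_lin algebra_simps, simp_all add: vadd_def smul_def algebra_simps)
  next
    fix z k assume "z \<in> M"
    then have "vfst m (sl1 z) \<in> P" "vfst m (sl3 z) \<in> P"
      by (simp_all add: M_iff W_fst)
    then show "N\<beta> (smul k z) = smul k (N\<beta> z)"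
      using v
      by (simp only: N\<beta>_def vfst_lin vsnd_lin t3_lin wvec_lin(2) vzero_lin smul_apply; intro t3_cong wvec_cong)
        (simp_all add: a0_lin chi_lin algebra_simps, simp_all add: vadd_def smul_def algebra_simps)
  qed
  show "lin_map M \<pi>\<beta>"
    by (rule lin_mapI) (simp_all add: \<pi>\<beta>_def vfst_lin vsnd_lin vadd_apply smul_apply t3_lin wvec_lin vzero_lin)
  fix z assume "z \<in> M"
  then have W: "sl1 z \<in> W" "sl2 z \<in> W" "sl3 z \<in> W" by (simp_all add: M_iff)
  then have "vadd (smul c (vfst m (sl1 z))) (smul (- (c * d)) (vfst m (sl3 z))) \<in> P"
    by (intro submodD[OF sub] W_fst)
  then show "N\<beta> z \<in> M" "\<pi>\<beta> z \<in> M" "\<pi>\<beta> (\<pi>\<beta> z) = \<pi>\<beta> z" "\<pi>\<beta> (N\<beta> z) = N\<beta> z" "N\<beta> (\<pi>\<beta> z) = vzero"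
    using W v vzero_P by (simp_all add: N\<beta>_def \<pi>\<beta>_def sl_t3 vzero_W t3_mem wvec_mem vfst_wvec vfst_vzero
      a0_vzero chi_vzero vzero_apply vzero_lin t3_vzero wvec_vzero)
qed

lemma unipotent_\<gamma>: "unipotent (mm + (mm + mm)) M hf N\<gamma> \<pi>\<gamma>"
proof
  show "fgproj (mm + (mm + mm)) M" "2 * hf = 1" by (rule M, rule hf)
  show "lin_map M N\<gamma>"
  proof (rule lin_mapI)
    fix z z' k
    show "N\<gamma> (vadd z z') = vadd (N\<gamma> z) (N\<gamma> z')" "N\<gamma> (smul k z) = smul k (N\<gamma> z)"
      unfolding N\<gamma>_def vfst_lin vsnd_lin t3_lin wvec_lin vzero_lin vadd_apply smul_apply 
      by (intro t3_cong wvec_cong; simp add: vadd_def smul_def algebra_simps)+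
  qed
  show "lin_map M \<pi>\<gamma>"
    by (rule lin_mapI) (simp_all add: \<pi>\<gamma>_def vfst_lin vsnd_lin vadd_apply smul_apply t3_lin wvec_lin vzero_lin)
  fix z assume "z \<in> M"
  then have W: "sl1 z \<in> W" "sl2 z \<in> W" "sl3 z \<in> W" by (simp_all add: M_iff)
  then have "smul (d * hf) (vfst m (sl3 z)) \<in> P"
    by (intro submodD[OF sub] W_fst)
  then show "N\<gamma> z \<in> M" "\<pi>\<gamma> z \<in> M" "\<pi>\<gamma> (\<pi>\<gamma> z) = \<pi>\<gamma> z" "\<pi>\<gamma> (N\<gamma> z) = N\<gamma> z" "N\<gamma> (\<pi>\<gamma> z) = vzero"
    using W vzero_P by (simp_all add: N\<gamma>_def \<pi>\<gamma>_def sl_t3 vzero_W t3_mem wvec_mem vfst_wvec W_fst vfst_vzero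
      vzero_apply vzero_lin t3_vzero wvec_vzero)
qed

lemma \<Phi>_\<alpha>:
  assumes "z \<in> M" "z' \<in> M"
  shows "oform mm Fd (hform mm Fc) z z' = \<Phi> (vadd z (N\<alpha> z)) (vadd z' (N\<alpha> z'))"
  using assms(1)
proof (rule M_cases)
  fix p q r assume pqr: "p \<in> W" "q \<in> W" "r \<in> W" and z: "z = t3 p q r"
  show ?thesis using assms(2)
  proof (rule M_cases)
    fix p' q' r' assume pqr': "p' \<in> W" "q' \<in> W" "r' \<in> W" and z': "z' = t3 p' q' r'"
    have zN: "vadd z (N\<alpha> z) = t3 p q (vadd r (vadd (T p) (U q)))"
      "vadd z' (N\<alpha> z') = t3 p' q' (vadd r' (vadd (T p') (U q')))"
      using pqr pqr' by (simp_all add: z z' N\<alpha>_def sl_t3 t3_lin vzero_lin)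
    have 1: "Fc q (vadd r' (vadd (T p') (U q'))) = Fc q r' - S q p' - hf * X q q'"
      using pqr pqr' by (simp add: altformD[OF alt(1)] TU_mem submodD[OF W_sub] Fc_T Fc_U)
    have 2: "Fc (vadd r (vadd (T p) (U q))) q' = Fc r q' - S p q' - hf * X q q'"
      using pqr pqr' altform_skew[OF W_sub alt(1) TU_mem(1), of p q'] altform_skew[OF W_sub alt(1) TU_mem(2), of q q']
      SX_skew(1)[of q' p] SX_skew(2)[of q' q]
      by (simp add: altformD[OF alt(1)] TU_mem submodD[OF W_sub] Fc_T Fc_U)
    \<comment> \<open>Both arguments contribute half of \<open>X\<close>, which explains the factor
      \<open>hf\<close> in \<open>U\<close>.\<close>
    have "hf * X q q' + hf * X q q' = X q q'"
      using hf by (metis distrib_right mult_1 mult_2)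
    then have 3: "X q q' - hf * X q q' - hf * X q q' = 0" by (metis add_diff_cancel_left' diff_self)
    have "\<Phi> (vadd z (N\<alpha> z)) (vadd z' (N\<alpha> z')) = Fd p p' + Fc q r' + Fc r q' + (X q q' - hf * X q q' - hf * X q q')"
      using pqr pqr' unfolding zN \<Phi>_def by (simp add: sl_t3 1 2)
    then show ?thesis
      using pqr pqr' unfolding 3 by (simp add: oform_def hform_def z z' sl_t3)
  qed
qed

lemma \<Psi>_\<beta>:
  assumes "z \<in> M" "z' \<in> M"
  shows "\<Psi> z z' = \<Phi> (vadd z (N\<beta> z)) (vadd z' (N\<beta> z'))"
  using assms(1)
proof (rule M_wvec_cases)
  fix p1 x1 y1 p2 x2 y2 p3 x3 y3
  assume p: "p1 \<in> P" "p2 \<in> P" "p3 \<in> P" and z: "z = t3 (wvec m p1 x1 y1) (wvec m p2 x2 y2) (wvec m p3 x3 y3)"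
  show ?thesis using assms(2)
  proof (rule M_wvec_cases)
    fix q1 X1 Y1 q2 X2 Y2 q3 X3 Y3
    assume q: "q1 \<in> P" "q2 \<in> P" "q3 \<in> P" and z': "z' = t3 (wvec m q1 X1 Y1) (wvec m q2 X2 Y2) (wvec m q3 X3 Y3)"
    let ?p = "vadd p2 (vadd (smul c p1) (smul (- (c * d)) p3))"
    let ?q = "vadd q2 (vadd (smul c q1) (smul (- (c * d)) q3))"
    have mem: "?p \<in> P" "?q \<in> P" using p q sub by (simp_all add: submodD)
    have zN: "vadd z (N\<beta> z) = t3 (wvec m p1 (x1 - a0 p3 - c * x3) (y1 + \<chi> v p3 - c * y3))
        (wvec m ?p (x2 + d * a0 p3 - a0 p1 + c * d * x3) (y2 + \<chi> v p1 - d * \<chi> v p3 + c * d * y3)) (wvec m p3 x3 y3)"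
      "vadd z' (N\<beta> z') = t3 (wvec m q1 (X1 - a0 q3 - c * X3) (Y1 + \<chi> v q3 - c * Y3))
        (wvec m ?q (X2 + d * a0 q3 - a0 q1 + c * d * X3) (Y2 + \<chi> v q1 - d * \<chi> v q3 + c * d * Y3)) (wvec m q3 X3 Y3)"
      using p q by (simp_all add: z z' N\<beta>_def sl_t3 wvec_mem vfst_wvec t3_lin wvec_lin vzero_lin algebra_simps)
    have lin: "\<chi> s ?q = \<chi> s q2 + c * \<chi> s q1 - c * d * \<chi> s q3" 
      "\<chi> ?p s = \<chi> p2 s + c * \<chi> p1 s - c * d * \<chi> p3 s"
      "\<chi> s ?p = \<chi> s p2 + c * \<chi> s p1 - c * d * \<chi> s p3" if "s \<in> P" for s
      using p q that sub by (simp_all add: chi_lin submodD)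
    have lin0: "a0 ?p = a0 p2 + c * a0 p1 - c * d * a0 p3" "a0 ?q = a0 q2 + c * a0 q1 - c * d * a0 q3"
      using p q sub by (simp_all add: a0_lin submodD)
    \<comment> \<open>What remains is a multiple of the section equation plus three Pluecker
      relations.\<close>
    have "\<Phi> (vadd z (N\<beta> z)) (vadd z' (N\<beta> z')) - \<Psi> z z'
      = (c * c * d * b + a0 v - 1) * (\<chi> p1 q3 + \<chi> p3 q1 - d * \<chi> p3 q3)
       + (a0 p1 * \<chi> v q3 - \<chi> v p1 * a0 q3 - a0 v * \<chi> p1 q3) 
       + (a0 p3 * \<chi> v q1 - \<chi> v p3 * a0 q1 - a0 v * \<chi> p3 q1) 
       - d * (a0 p3 * \<chi> v q3 - \<chi> v p3 * a0 q3 - a0 v * \<chi> p3 q3)"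
      unfolding zN \<Phi>_def \<Psi>_def S_def X_def using p q v mem
      by (simp add: z z' sl_t3 wvec_mem vfst_wvec fm_wvec lin lin0) (simp add: algebra_simps)
    also have "\<dots> = 0"
      using plucker[OF v p(1) q(3)] plucker[OF v p(3) q(1)] plucker[OF v p(3) q(3)] unit by simp
    finally show ?thesis by simp
  qed
qed

lemma \<Psi>_\<gamma>:
  assumes "z \<in> M" "z' \<in> M"
  shows "oform mm Fe (hform mm \<omega>) (cyc3 z) (cyc3 z') = \<Psi> (vadd z (N\<gamma> z)) (vadd z' (N\<gamma> z'))"
  using assms(1)
proof (rule M_wvec_cases)
  fix p1 x1 y1 p2 x2 y2 p3 x3 y3
  assume p: "p1 \<in> P" "p2 \<in> P" "p3 \<in> P" and z: "z = t3 (wvec m p1 x1 y1) (wvec m p2 x2 y2) (wvec m p3 x3 y3)"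
  show ?thesis using assms(2)
  proof (rule M_wvec_cases)
    fix q1 X1 Y1 q2 X2 Y2 q3 X3 Y3
    assume q: "q1 \<in> P" "q2 \<in> P" "q3 \<in> P" and z': "z' = t3 (wvec m q1 X1 Y1) (wvec m q2 X2 Y2) (wvec m q3 X3 Y3)"
    let ?p = "vadd p1 (smul (d * hf) p3)" and ?q = "vadd q1 (smul (d * hf) q3)"
    have mem: "?p \<in> P" "?q \<in> P" using p q sub by (simp_all add: submodD)
    have zN: "vadd z (N\<gamma> z) = t3 (wvec m ?p x1 y1) (wvec m p2 (x2 - d * hf * x1) (y2 - d * hf * y1)) (wvec m p3 x3 y3)"
      "vadd z' (N\<gamma> z') = t3 (wvec m ?q X1 Y1) (wvec m q2 (X2 - d * hf * X1) (Y2 - d * hf * Y1)) (wvec m q3 X3 Y3)"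
      using p q by (simp_all add: z z' N\<gamma>_def sl_t3 wvec_mem vfst_wvec t3_lin wvec_lin vzero_lin)
    have lin: "\<chi> p3 ?q = \<chi> p3 q1 + d * hf * \<chi> p3 q3" "\<chi> ?p q3 = \<chi> p1 q3 + d * hf * \<chi> p3 q3"
      using p q sub by (simp_all add: chi_lin submodD)
    have "\<Psi> (vadd z (N\<gamma> z)) (vadd z' (N\<gamma> z')) - oform mm Fe (hform mm \<omega>) (cyc3 z) (cyc3 z')
      = (2 * hf - 1) * d * (\<chi> p3 q3 - (x1 * Y1 - y1 * X1))"
      unfolding zN \<Psi>_def using p q mem
      by (simp add: z z' cyc3_def oform_def hform_def sl_t3 wvec_mem vfst_wvec omega_wvec lin) (simp add: algebra_simps)
    then show ?thesis by (simp add: hf)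
  qed
qed

text \<open>All triples share the first form \<open>\<omega>\<close> plus hyperbolic
  \<open>\<omega>\<close>. The second form runs from \<open>Fe\<close> plus hyperbolic
  \<open>\<omega>\<close>, through \<open>\<Psi>\<close> and \<open>\<Phi>\<close>, to
  \<open>Fd\<close> plus hyperbolic \<open>Fc\<close>; every passage is by an automorphism of
  trivial class.\<close>

lemma K_step: "K (c * c * d) b v \<approx> K d (b * c * c) v + (K c (b * c * d) v + K c (b * c * d) v)"
proof -
  interpret \<alpha>: unipotent "mm + (mm + mm)" M hf N\<alpha> \<pi>\<alpha> by (rule unipotent_\<alpha>)
  interpret \<beta>: unipotent "mm + (mm + mm)" M hf N\<beta> \<pi>\<beta> by (rule unipotent_\<beta>)
  interpret \<gamma>: unipotent "mm + (mm + mm)" M hf N\<gamma> \<pi>\<gamma> by (rule unipotent_\<gamma>)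
  let ?H = "hform mm \<omega>" and ?c = "\<lambda>f. delta (mm + (mm + mm), M, oform mm \<omega> (hform mm \<omega>), f)"
  note WWsub = fgproj_submod[OF WW]
  have altH: "altform (osum mm W W) (hform mm f)" if "altform W f" for f
    by (rule altform_hform[OF W hf im that])
  have altO: "altform M (oform mm f (hform mm g))" if "altform W f" "altform W g" for f g
    unfolding M_def by (rule altform_osum[OF W_sub WWsub that(1) altH[OF that(2)]])
  \<comment> \<open>Evaluates the two ends of the chain: the hyperbolic summand contributes 0 for
    \<open>\<omega>\<close> and, by \<open>cl_hform\<close>, twice the class of
    \<open>Fc\<close>.\<close>
  have split: "?c (oform mm f (hform mm g)) \<approx> K' + L'"
    if "altform W f" "altform W g" "delta (mm, W, \<omega>, f) \<approx> K'" 
      "delta (mm + mm, osum mm W W, ?H, hform mm g) \<approx> L'" for f g K' L'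
  proof -
    have "?c (oform mm f (hform mm g)) \<approx> delta (mm, W, \<omega>, f) + delta (mm + mm, osum mm W W, ?H, hform mm g)"
      using cl_sum[of "(mm, W, \<omega>, f)" "(mm + mm, osum mm W W, ?H, hform mm g)"] that(1,2) 
        W WW altform_omega altH by (simp add: M_def)
    also have "\<dots> \<approx> K' + L'" by (intro veq_add that)
    finally show ?thesis .
  qed
  note om = altO[OF altform_omega altform_omega]
  have \<Phi>: "altform M \<Phi>"
    using \<alpha>.altform_iff[where f' = "oform mm Fd (hform mm Fc)" and f = \<Phi>, OF \<Phi>_\<alpha>] altO[OF alt(2,1)] by simp
  have \<Psi>: "altform M \<Psi>"
    using \<beta>.altform_iff[where f' = \<Psi> and f = \<Phi>, OF \<Psi>_\<beta>] \<Phi> by simp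
  have "K (c * c * d) b v + 0 \<approx> ?c (oform mm Fe ?H)"
    by (rule veq_sym[OF split]) (use alt altform_omega cl_same[OF WW altH[OF altform_omega]] in \<open>auto simp: K_def\<close>)
  also have "\<dots> \<approx> ?c (pull cyc3 (oform mm Fe ?H))"
    by (rule veq_sym, rule cl_aut_null[OF M aut_cyc3 aut_swap om altO[OF alt(3) altform_omega] swap_cyc3])
      (simp_all add: pull_def)
  also have "\<dots> \<approx> ?c \<Psi>"
    by (rule \<gamma>.cl_eq[OF om \<Psi>]) (simp add: pull_def \<Psi>_\<gamma>)
  also have "\<dots> \<approx> ?c \<Phi>" by (rule \<beta>.cl_eq[where f' = \<Psi> and f = \<Phi>, OF om \<Phi> \<Psi>_\<beta>])
  also have "\<dots> \<approx> ?c (oform mm Fd (hform mm Fc))"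
    by (rule veq_sym[OF \<alpha>.cl_eq[where f' = "oform mm Fd (hform mm Fc)" and f = \<Phi>, OF om \<Phi> \<Phi>_\<alpha>]])
  also have "\<dots> \<approx> K d (b * c * c) v + (K c (b * c * d) v + K c (b * c * d) v)"
    by (rule split) (use alt cl_hform[OF W hf im altform_omega alt(1)] in \<open>auto simp: K_def\<close>)
  finally show ?thesis by simp
qed

end

section \<open>Powers\<close>

context vaserstein
begin

lemma unimodular_power:
  assumes "v \<in> P" "e * b + a0 v = 1"
  obtains b' v' where "v' \<in> P" "e ^ n * b' + a0 v' = 1"
proof -
  have "\<exists>b' v'. v' \<in> P \<and> e ^ n * b' + a0 v' = 1"
  proof (induction n)
    case 0
    then show ?case using a0_vzero vzero_P by (intro exI[of _ 1] exI[of _ vzero]) simp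
  next
    case (Suc n)
    then obtain b' v' where v': "v' \<in> P" "e ^ n * b' + a0 v' = 1" by blast
    \<comment> \<open>Obtained by multiplying \<open>e * b + a0 v = 1\<close> by
      \<open>e ^ n * b'\<close> and substituting into the equation for \<open>n\<close>.\<close>
    let ?v = "vadd (smul (e ^ n * b') v) v'"
    have "a0 ?v = e ^ n * b' * a0 v + a0 v'"
      using assms(1) v'(1) sub by (simp add: a0_lin submodD)
    then have "e ^ Suc n * (b * b') + a0 ?v = e ^ n * b' * (e * b + a0 v) + a0 v'"
      by (simp add: algebra_simps)
    then have "e ^ Suc n * (b * b') + a0 ?v = 1" using assms(2) v'(2) by simp
    moreover have "?v \<in> P" using assms(1) v'(1) sub by (simp add: submodD)
    ultimately show ?case by blast
  qed
  then show thesis using that by blast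
qed

text \<open>Induction in steps of two by \<open>K_step\<close> with \<open>c = e\<close> and
  \<open>d = e ^ n\<close>. The section is generalised because \<open>K_step\<close> produces
  sections of its own.\<close>

lemma K_power:
  assumes v: "v \<in> P" "e * b + a0 v = 1" and v': "v' \<in> P" "e ^ n * b' + a0 v' = 1"
  shows "K (e ^ n) b' v' \<approx> (\<lambda>S. int n * K e b v S)"
  using v'
proof (induction n arbitrary: b' v' rule: nat_induct2)
  case 0
  then show ?case using K_1[of v' b'] by (simp flip: zero_fun_def)
next
  case 1
  then show ?case using K_section[OF v] by simp
next
  case (step n)
  have unit: "e * e * e ^ n * b' + a0 v' = 1" using step.prems(2) by (simp add: power_add power2_eq_square mult_ac)
  interpret step: vaserstein_step m P w hf im a0 b' e "e ^ n" v'
    by unfold_locales (rule step.prems(1), rule unit)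
  have "K e (b' * e * e ^ n) v' \<approx> K e b v"
    by (rule K_section[OF v step.prems(1)]) (use unit in \<open>simp add: mult_ac\<close>)
  moreover have "K (e ^ n) (b' * e * e) v' \<approx> (\<lambda>S. int n * K e b v S)"
    by (rule step.IH[OF step.prems(1)]) (use unit in \<open>simp add: mult_ac\<close>)
  ultimately have "K (e * e * e ^ n) b' v' \<approx> (\<lambda>S. int n * K e b v S) + (K e b v + K e b v)"
    using step.K_step by (blast intro: veq_trans veq_add)
  moreover have "(\<lambda>S. int n * K e b v S) + (K e b v + K e b v) = (\<lambda>S. int (n + 2) * K e b v S)"
    by (auto simp: plus_fun_def algebra_simps)
  moreover have "e ^ (n + 2) = e * e * e ^ n" by (simp add: power_add power2_eq_square mult_ac)
  ultimately show ?case by (simp only:)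
qed

section \<open>Comparison with the Vaserstein symbol\<close>

lemma Vsym_eq_K:
  assumes "v0 \<in> P" "e * b0 + a0 v0 = 1"
  obtains b v where "v \<in> P" "e * b + a0 v = 1" "K e b v \<approx> delta (Vsym m P w a0 e)"
proof -
  let ?O = "osum m P (vecs 1)" and ?a = "ahom m a0 e"
  define s where "s = (SOME s. s \<in> ?O \<and> ?a s = 1)"
  \<comment> \<open>The given \<open>(v0, b0)\<close> shows that the choice inside
    \<open>Vsym\<close> is not vacuous; the section returned is the chosen one.\<close>
  have "\<exists>s. s \<in> ?O \<and> ?a s = 1"
  proof (intro exI conjI)
    let ?s = "vsum m v0 (\<lambda>i. if i = 0 then b0 else 0)"
    show "?s \<in> ?O" using assms(1) by (intro osumI) (auto simp: vecs_def)
    show "?a ?s = 1" using assms by (simp add: ahom_def vfst_vsum[OF sub]) (simp add: vsum_def algebra_simps)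
  qed
  from someI_ex[OF this] have s: "s \<in> ?O" "?a s = 1" by (simp_all add: s_def)
  define b v where "b = s m" and "v = vfst m s"
  have subO: "submod (m + 1) ?O" by (rule submod_osum[OF sub fgproj_submod[OF fgproj_vecs]])
  have v: "v \<in> P" using s(1) by (simp add: v_def osum_iff[OF sub])
  have unit: "e * b + a0 v = 1" using s(2) by (simp add: ahom_def b_def v_def algebra_simps)
  define rs where "rs = (\<lambda>x. vadd x (smul (- ?a x) s))"
  define I where "I = (\<lambda>x. vsum (m + 1) (rs (vfst (m + 1) x))
                (\<lambda>i. if i = 0 then ?a (vfst (m + 1) x) else if i = 1 then x (m + 1) else 0))"
  have V: "Vsym m P w a0 e = (m + 2, osum m P (vecs 2), oform m \<chi> psi2,
      \<lambda>x y. oform (m + 1) (chi_a m w s) psi2 (I x) (I y))"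
    by (simp add: Vsym_def Let_def s_def rs_def I_def)
  have form: "oform (m + 1) (chi_a m w s) psi2 (I x) (I y) = fm e b v x y" if x: "x \<in> W" and y: "y \<in> W" for x y
  proof -
    let ?k = "\<lambda>x. a0 (vfst m x) + e * x m"
    have mem: "vfst (m + 1) x \<in> ?O" if "x \<in> W" for x
    proof -
      have "vfst m (vfst (m + 1) x) = vfst m x" by (auto simp: vfst_def)
      moreover have "vsnd m (vfst (m + 1) x) \<in> vecs 1" by (auto simp: vsnd_def vfst_def vecs_def)
      ultimately show ?thesis using W_fst[OF that] by (simp add: osum_iff[OF sub])
    qed
    have k: "?a (vfst (m + 1) x) = ?k x" for x
    proof -
      have "vfst m (vfst (m + 1) x) = vfst m x" by (auto simp: vfst_def)
      then show ?thesis by (simp add: ahom_def) (simp add: vfst_def)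
    qed
    have rs: "rs (vfst (m + 1) x) \<in> ?O" if "x \<in> W" for x
      using mem[OF that] s(1) unfolding rs_def by (intro submodD[OF subO])
    have rs_m: "rs (vfst (m + 1) x) m = x m - ?k x * b" for x
      unfolding rs_def k by (simp add: vadd_def smul_def b_def) (simp add: vfst_def algebra_simps)
    have rs_fst: "vfst m (rs (vfst (m + 1) x)) = vadd (vfst m x) (smul (- ?k x) v)" for x
      unfolding rs_def k vfst_lin v_def by (simp add: vfst_def vadd_def smul_def fun_eq_iff)
    have "oform (m + 1) (chi_a m w s) psi2 (I x) (I y)
      = chi_a m w s (rs (vfst (m + 1) x)) (rs (vfst (m + 1) y)) + (?k x * y (Suc m) - x (Suc m) * ?k y)"
      unfolding oform_def I_def vsnd_vsum k vfst_vsum[OF subO rs[OF x]] vfst_vsum[OF subO rs[OF y]]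
      by (simp add: psi2_def)
    \<comment> \<open>In \<open>chi_a_eq\<close> the terms with the factors \<open>?k x * b\<close>
      and \<open>?k y * b\<close> cancel by skew-symmetry, and
      \<open>\<chi> v v = 0\<close>.\<close>
    also have "chi_a m w s (rs (vfst (m + 1) x)) (rs (vfst (m + 1) y))
      = b * \<chi> (vfst m x) (vfst m y) + y m * \<chi> v (vfst m x) - x m * \<chi> v (vfst m y)"
      unfolding chi_a_eq[OF rs[OF x] rs[OF y] s(1)] rs_m rs_fst b_def[symmetric] v_def[symmetric]
      using W_fst[OF x] W_fst[OF y] v sub chi_skew[OF W_fst[OF x] v] chi_skew[OF W_fst[OF y] v]
      by (simp add: chi_lin submodD chi_diag algebra_simps)
    finally show ?thesis by (simp add: fm_def algebra_simps)
  qed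
  have "K e b v \<approx> delta (mm, W, oform m \<chi> psi2, \<lambda>x y. oform (m + 1) (chi_a m w s) psi2 (I x) (I y))"
    unfolding K_def using W altform_omega altform_fm[OF v unit] form
    by (intro cl_cong) (simp_all add: \<omega>_def)
  then have "K e b v \<approx> delta (Vsym m P w a0 e)"
    by (simp add: V mm_def W_def)
  then show thesis using that v unit by blast
qed

lemma Vsym_power:
  assumes v0: "v0 \<in> P" "e * b0 + a0 v0 = 1"
  shows "delta (Vsym m P w a0 (e ^ n)) \<approx> (\<lambda>S. int n * delta (Vsym m P w a0 e) S)"
proof -
  obtain b v where 1: "v \<in> P" "e * b + a0 v = 1" "K e b v \<approx> delta (Vsym m P w a0 e)"
    using Vsym_eq_K[OF v0] by blast
  \<comment> \<open>Some section of \<open>(a0, e ^ n)\<close> is needed first; it is then exchanged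
    for the one used by the symbol.\<close>
  obtain b' v' where "v' \<in> P" "e ^ n * b' + a0 v' = 1"
    using unimodular_power[OF v0] by blast
  then obtain b' v' where 2: "v' \<in> P" "e ^ n * b' + a0 v' = 1" "K (e ^ n) b' v' \<approx> delta (Vsym m P w a0 (e ^ n))"
    using Vsym_eq_K by blast
  have scale: "(\<lambda>S. int k * x S) \<approx> (\<lambda>S. int k * y S)" if "x \<approx> y" for k x and y :: "'r triple \<Rightarrow> int"
  proof (induction k)
    case (Suc k)
    from veq_add[OF this that] show ?case by (simp add: plus_fun_def algebra_simps)
  qed simp
  show ?thesis
    using veq_trans[OF veq_sym[OF 2(3)] veq_trans[OF K_power[OF 1(1,2) 2(1,2)] scale[OF 1(3)]]] .
qed

end

theorem theorem3p1:
  fixes \<phi> :: "'k::field \<Rightarrow> 'r::comm_ring_1"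
    and m0 :: nat and P0 :: "'r vec set" and w :: "nat \<Rightarrow> nat \<Rightarrow> 'r"
    and a0 :: "'r vec \<Rightarrow> 'r" and aR :: 'r and n :: nat
  assumes "perfect_field TYPE('k)"
    and "(2::'k) \<noteq> 0"
    and "\<exists>i::'k. i * i = - 1"
    and "smooth_alg \<phi>"
    and "fgproj m0 P0" and "has_rank P0 2"
    and "det_triv P0 w"
    and "n mod 4 = 0 \<or> n mod 4 = 1"
    and "Um (osum m0 P0 (vecs 1)) (ahom m0 a0 aR)"
  shows "(\<lambda>S. delta (Vsym m0 P0 w a0 (aR ^ n)) S - int n * delta (Vsym m0 P0 w a0 aR) S) \<in> VRel"
proof -
  have hom: "\<phi> 1 = 1" "\<phi> (x + y) = \<phi> x + \<phi> y" "\<phi> (x * y) = \<phi> x * \<phi> y" for x y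
    using assms(4) by (auto simp: smooth_alg_def alg_map_def)
  \<comment> \<open>Additivity yields \<open>\<phi> 0 = 0\<close> and
    \<open>\<phi> (- 1) = - 1\<close>, so one half and a square root of -1 pass from the field to
    the ring.\<close>
  have "\<phi> 0 + \<phi> 0 = \<phi> 0" using hom(2)[of 0 0] by simp
  then have "\<phi> (- 1) + 1 = 0" using hom(2)[of "- 1" 1] by (simp add: hom(1))
  then have minus: "\<phi> (- 1) = - 1" by (simp add: add_eq_0_iff2)
  obtain i where i: "i * i = (- 1 :: 'k)" using assms(3) by blast
  have hf: "2 * \<phi> (1 / 2) = 1"
    using hom(2)[of "1 / 2" "1 / 2"] assms(2) hom(1) by (simp add: field_simps flip: mult_2)
  have im: "\<phi> i * \<phi> i = - 1" by (simp add: i minus flip: hom(3))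
  note sub = fgproj_submod[OF assms(5)]
  let ?O = "osum m0 P0 (vecs 1)" and ?a = "ahom m0 a0 aR"
  have lin: "lin_on ?O ?a" and ex: "\<exists>p\<in>?O. ?a p = 1" using assms(9) by (auto simp: Um_def)
  \<comment> \<open>Linearity of \<open>a0\<close> is obtained by restricting the epimorphism along
    \<open>p \<mapsto> (p, 0)\<close>.\<close>
  have emb: "vsum m0 p vzero \<in> ?O" "?a (vsum m0 p vzero) = a0 p" if "p \<in> P0" for p
    using that by (auto intro!: osumI simp: vecs_def vzero_def ahom_def vfst_vsum[OF sub]) (simp add: vsum_def)
  have a0: "lin_on P0 a0"
    unfolding lin_on_def
  proof (intro conjI ballI allI)
    fix x y assume x: "x \<in> P0" and y: "y \<in> P0"
    have "?a (vadd (vsum m0 x vzero) (vsum m0 y vzero)) = a0 x + a0 y"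
      using lin_onD(1)[OF lin] emb x y by simp
    then show "a0 (vadd x y) = a0 x + a0 y"
      using emb(2) x y sub by (simp add: vsum_lin vzero_lin submodD)
  next
    fix c x assume x: "x \<in> P0"
    have "?a (smul c (vsum m0 x vzero)) = c * a0 x"
      using lin_onD(2)[OF lin] emb x by simp
    then show "a0 (smul c x) = c * a0 x"
      using emb(2) x sub by (simp add: vsum_lin vzero_lin submodD)
  qed
  interpret vaserstein m0 P0 w "\<phi> (1 / 2)" "\<phi> i" a0
    by unfold_locales (rule assms(5), rule assms(7), rule hf, rule im, rule a0)
  \<comment> \<open>A preimage of 1 is a section; its two components are the required
    \<open>v0\<close> and \<open>b0\<close>.\<close>
  obtain s where "s \<in> ?O" "?a s = 1" using ex by blast
  then have "vfst m0 s \<in> P0" "aR * s m0 + a0 (vfst m0 s) = 1"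
    by (simp_all add: osum_iff[OF sub] ahom_def algebra_simps)
  from Vsym_power[OF this, of n] show ?thesis
    by (simp add: veq_def fun_diff_def)
qed

end
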